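(* Let $\Omega\subset\mathbb{C}^{n}$ be a bounded domain, and let $\rho:\Omega\to[-1,0)$ be a smooth strictly plurisubharmonic exhaustion function. Set $g=-\log(-\rho)$ and $\omega=dd^{c}g$. For $\alpha>\frac{n}{2}$, set $f=(-\rho)^{\alpha}$. Then $$f\in W^{1,2}(\Omega,\omega)\quad\Longleftrightarrow\quad\int_{\Omega}(-\rho)^{2\alpha-n}(dd^{c}\rho)^{n}<+\infty.$$ If these equivalent conditions hold, then $$\int_{\Omega}f^{2}\,\omega^{n}=\frac{2\alpha}{2\alpha-n}\int_{\Omega}(-\rho)^{2\alpha-n}(dd^{c}\rho)^{n}$$ and $$4\int_{\Omega}|\partial f|_{\omega}^{2}\,\omega^{n}=2\alpha n\int_{\Omega}f^{2}\,\omega^{n}.$$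
   Context: Conventions: $d^{c}u=\frac{\sqrt{-1}}{2}(\bar\partial-\partial)u$, so $dd^{c}u=\sqrt{-1}\,\partial\bar\partial u$. Subscripts denote derivatives: $u_i=\partial u/\partial z^i$, $u_{\bar j}=\partial u/\partial\bar z^j$, $u_{i\bar j}=\partial^2u/\partial z^i\partial\bar z^j$. A smooth strictly plurisubharmonic function is one whose complex Hessian $(\rho_{i\bar j})$ is positive definite at every point. A function $\rho:\Omega\to[-1,0)$ is an exhaustion function if $\{z\in\Omega:\rho(z)<c\}\Subset\Omega$ (relatively compact in $\Omega$) for every $c<0$. The form $\omega=dd^{c}g=\sqrt{-1}\sum_{i,j} g_{i\bar j}\,dz^i\wedge d\bar z^j$ is identified with the K\"ahler metric with tensor $(g_{i\bar j})$, and $(g^{\bar j i})=(g_{i\bar j})^{-1}$. For a real-valued function $f$, $|\partial f|_{\omega}^{2}=\sum_{i,j=1}^{n}g^{\bar j i}f_{i}f_{\bar j}$. The measure $\omega^n$ ($n$-fold wedge power) is used as the reference volume measure, and $W^{1,2}(\Omega,\omega)$ is the Sobolev space of functions in $L^2(\Omega,\omega^n)$ whose (weak) gradient is square integrable with respect to $\omega$; for a smooth real-valued $f$, membership means $\int_\Omega f^2\,\omega^n<+\infty$ and $\int_\Omega|\partial f|_\omega^2\,\omega^n<+\infty$. *)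

theory Defs
  imports "HOL-Analysis.Analysis"
begin

text \<open>
  A point of \<open>\<complex>\<^sup>n\<close> is a vector of type \<^typ>\<open>complex ^ 'n\<close>, with \<open>n = CARD('n)\<close>. Functions on a
  domain \<open>\<Omega>\<close> are total functions of which only the values on \<open>\<Omega>\<close> matter; since \<open>\<Omega>\<close> is open,
  this also determines all derivatives at points of \<open>\<Omega>\<close>.
\<close>

primrec Ck_on :: "nat \<Rightarrow> 'a::real_normed_vector set \<Rightarrow> ('a \<Rightarrow> 'b::real_normed_vector) \<Rightarrow> bool" where
  "Ck_on 0 S f \<longleftrightarrow> continuous_on S f"
| "Ck_on (Suc k) S f \<longleftrightarrow>
     (\<forall>x\<in>S. f differentiable (at x)) \<and> (\<forall>v. Ck_on k S (\<lambda>x. frechet_derivative f (at x) v))"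

definition smooth_on :: "'a::real_normed_vector set \<Rightarrow> ('a \<Rightarrow> 'b::real_normed_vector) \<Rightarrow> bool" where
  "smooth_on S f \<longleftrightarrow> (\<forall>k. Ck_on k S f)"

text \<open>
  Wirtinger derivatives \<open>\<partial>/\<partial>z\<^sup>i = (\<partial>/\<partial>x\<^sup>i - \<i> \<partial>/\<partial>y\<^sup>i) / 2\<close> and
  \<open>\<partial>/\<partial>z\<^bold>\<bar>\<^sup>i = (\<partial>/\<partial>x\<^sup>i + \<i> \<partial>/\<partial>y\<^sup>i) / 2\<close>, where \<open>z\<^sup>i = x\<^sup>i + \<i> y\<^sup>i\<close>.
\<close>

definition dz :: "'n \<Rightarrow> (complex ^ 'n \<Rightarrow> complex) \<Rightarrow> complex ^ 'n \<Rightarrow> complex" where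
  "dz i u z = (frechet_derivative u (at z) (axis i 1)
               - \<i> * frechet_derivative u (at z) (axis i \<i>)) / 2"

definition dzbar :: "'n \<Rightarrow> (complex ^ 'n \<Rightarrow> complex) \<Rightarrow> complex ^ 'n \<Rightarrow> complex" where
  "dzbar i u z = (frechet_derivative u (at z) (axis i 1)
                  + \<i> * frechet_derivative u (at z) (axis i \<i>)) / 2"

definition complex_hessian :: "(complex ^ 'n \<Rightarrow> real) \<Rightarrow> complex ^ 'n \<Rightarrow> complex ^ 'n ^ 'n" where
  "complex_hessian u z = (\<chi> i j. dz i (dzbar j (\<lambda>w. complex_of_real (u w))) z)"

text \<open>Over \<open>\<complex>\<close>, the first conjunct for all \<open>\<xi>\<close> is equivalent to \<open>A\<close> being Hermitian.\<close>

definition positive_definite :: "complex ^ 'n ^ 'n \<Rightarrow> bool" where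
  "positive_definite A \<longleftrightarrow>
     (\<forall>\<xi>. \<xi> \<noteq> 0 \<longrightarrow>
        (\<Sum>i\<in>UNIV. \<Sum>j\<in>UNIV. A $ i $ j * \<xi> $ i * cnj (\<xi> $ j)) \<in> \<real> \<and>
        Re (\<Sum>i\<in>UNIV. \<Sum>j\<in>UNIV. A $ i $ j * \<xi> $ i * cnj (\<xi> $ j)) > 0)"

definition smooth_strictly_psh_on :: "(complex ^ 'n) set \<Rightarrow> (complex ^ 'n \<Rightarrow> real) \<Rightarrow> bool" where
  "smooth_strictly_psh_on \<Omega> u \<longleftrightarrow>
     smooth_on \<Omega> u \<and> (\<forall>z\<in>\<Omega>. positive_definite (complex_hessian u z))"

definition exhaustion_on :: "'a::topological_space set \<Rightarrow> ('a \<Rightarrow> real) \<Rightarrow> bool" where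
  "exhaustion_on \<Omega> \<rho> \<longleftrightarrow>
     (\<forall>c<0. compact (closure {z\<in>\<Omega>. \<rho> z < c}) \<and> closure {z\<in>\<Omega>. \<rho> z < c} \<subseteq> \<Omega>)"

text \<open>
  The two-form \<open>dd\<^sup>c u = \<i> \<Sum>\<^sub>i\<^sub>j u\<^sub>i\<^sub>j dz\<^sup>i \<and> dz\<^bold>\<bar>\<^sup>j\<close> at \<open>z\<close>, as an alternating bilinear form on
  the real vector space \<open>\<complex>\<^sup>n\<close>, using
  \<open>(dz\<^sup>i \<and> dz\<^bold>\<bar>\<^sup>j)(v, w) = v\<^sub>i cnj w\<^sub>j - w\<^sub>i cnj v\<^sub>j\<close>.
\<close>

definition ddc :: "(complex ^ 'n \<Rightarrow> real) \<Rightarrow> complex ^ 'n \<Rightarrow> complex ^ 'n \<Rightarrow> complex ^ 'n \<Rightarrow> complex" where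
  "ddc u z v w = \<i> * (\<Sum>i\<in>UNIV. \<Sum>j\<in>UNIV.
     complex_hessian u z $ i $ j * (v $ i * cnj (w $ j) - w $ i * cnj (v $ j)))"

text \<open>
  The \<open>n\<close>-fold wedge power of a two-form \<open>\<beta>\<close>, evaluated on \<open>2n\<close> vectors:
  \<open>\<beta>\<^sup>n(v\<^sub>1, \<dots>, v\<^sub>2\<^sub>n) = 2\<^sup>-\<^sup>n \<Sum>\<^sub>\<sigma> sgn \<sigma> \<Prod>\<^sub>k \<beta>(v\<^bsub>\<sigma>(2k-1)\<^esub>, v\<^bsub>\<sigma>(2k)\<^esub>)\<close>, the sum being
  over all permutations of the \<open>2n\<close> indices. The positions \<open>2k-1\<close> and \<open>2k\<close> are encoded as
  \<open>(k, False)\<close> and \<open>(k, True)\<close>; the order of the pairs among themselves is irrelevant.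
\<close>

definition wedge_power :: "('v \<Rightarrow> 'v \<Rightarrow> complex) \<Rightarrow> ('n::finite \<times> bool \<Rightarrow> 'v) \<Rightarrow> complex" where
  "wedge_power \<beta> v =
     (\<Sum>\<sigma> | \<sigma> permutes UNIV.
        of_int (sign \<sigma>) * (\<Prod>k\<in>UNIV. \<beta> (v (\<sigma> (k, False))) (v (\<sigma> (k, True))))) / 2 ^ CARD('n)"

text \<open>
  The positively oriented real basis \<open>\<partial>/\<partial>x\<^sup>1, \<partial>/\<partial>y\<^sup>1, \<dots>, \<partial>/\<partial>x\<^sup>n, \<partial>/\<partial>y\<^sup>n\<close> of \<open>\<complex>\<^sup>n\<close>.
\<close>

definition real_frame :: "'n \<times> bool \<Rightarrow> complex ^ 'n" where
  "real_frame p = axis (fst p) (if snd p then \<i> else 1)"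

text \<open>
  The measure \<open>(dd\<^sup>c u)\<^sup>n\<close> on \<open>\<Omega>\<close>. The value of a top-degree form on the frame above is its density
  with respect to \<open>dx\<^sup>1 \<and> dy\<^sup>1 \<and> \<dots> \<and> dx\<^sup>n \<and> dy\<^sup>n\<close>, that is, Lebesgue measure. This is a real number,
  nonnegative for plurisubharmonic \<open>u\<close>.
\<close>

definition ddc_power_measure ::
    "(complex ^ 'n) set \<Rightarrow> (complex ^ 'n \<Rightarrow> real) \<Rightarrow> (complex ^ 'n) measure" where
  "ddc_power_measure \<Omega> u =
     density (restrict_space lborel \<Omega>) (\<lambda>z. ennreal (Re (wedge_power (ddc u z) real_frame)))"

text \<open>
  \<open>|\<partial>f|\<^sup>2\<close> with respect to the metric \<open>dd\<^sup>c g\<close>. The matrix \<open>(g\<^sub>i\<^sub>j)\<close> has row index \<open>i\<close> and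
  column index \<open>j\<close> (the barred one), so the barred index labels the rows of the inverse. The sum
  is real because the metric is Hermitian and \<open>f\<close> is real-valued.
\<close>

definition norm_del_sq ::
    "(complex ^ 'n \<Rightarrow> real) \<Rightarrow> (complex ^ 'n \<Rightarrow> real) \<Rightarrow> complex ^ 'n \<Rightarrow> real" where
  "norm_del_sq g f z = Re (\<Sum>i\<in>UNIV. \<Sum>j\<in>UNIV.
     matrix_inv (complex_hessian g z) $ j $ i
       * dz i (\<lambda>w. complex_of_real (f w)) z * dzbar j (\<lambda>w. complex_of_real (f w)) z)"

text \<open>
  The smooth real-valued elements of the Sobolev space \<open>W\<^sup>1\<^sup>,\<^sup>2(\<Omega>, dd\<^sup>c g)\<close>: for smooth functions
  the weak gradient is the classical one.
\<close>

definition smooth_W12 ::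
    "(complex ^ 'n) set \<Rightarrow> (complex ^ 'n \<Rightarrow> real) \<Rightarrow> (complex ^ 'n \<Rightarrow> real) set" where
  "smooth_W12 \<Omega> g = {f. smooth_on \<Omega> f \<and>
     (\<integral>\<^sup>+ z. ennreal ((f z)\<^sup>2) \<partial>ddc_power_measure \<Omega> g) < \<infinity> \<and>
     (\<integral>\<^sup>+ z. ennreal (norm_del_sq g f z) \<partial>ddc_power_measure \<Omega> g) < \<infinity>}"

end

theory Submission
  imports Defs
begin

text \<open>
  Write \<open>r = -\<rho>\<close>, let \<open>H\<close> be the complex Hessian of \<open>\<rho>\<close> and \<open>q = |\<partial>\<rho>|\<^sup>2\<close> with respect to \<open>H\<close>. The Hessian
  of \<open>g\<close> is the rank-one update \<open>(H + \<partial>\<rho> \<otimes> \<partial>\<rho> / r) / r\<close>, so \<open>det (g\<^sub>i\<^sub>j) = r\<^sup>-\<^sup>n det H (1 + q / r)\<close> and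
  \<open>|\<partial>f|\<^sup>2 = \<alpha>\<^sup>2 r\<^sup>2\<^sup>\<alpha> (q / r) / (1 + q / r)\<close>. With \<open>\<beta> = 2\<alpha> - n\<close>, all three integrals are therefore linear
  combinations of \<open>\<integral> r\<^sup>\<beta> det H\<close> and \<open>\<integral> r\<^sup>\<beta>\<^sup>-\<^sup>1 q det H\<close>, and everything follows from
  \<open>n \<integral> r\<^sup>\<beta> det H = \<beta> \<integral> r\<^sup>\<beta>\<^sup>-\<^sup>1 q det H\<close>. This is obtained by integrating by parts
  \<open>n \<integral> h(r) det H = \<integral> h'(r) q det H\<close> for \<open>h\<close> vanishing near \<open>0\<close>, where \<open>h(r)\<close> has compact support because
  \<open>\<rho>\<close> is an exhaustion, and letting \<open>h\<close> increase to \<open>r\<^sup>\<beta>\<close>. The factor between \<open>(dd\<^sup>c u)\<^sup>n\<close> and \<open>det (u\<^sub>i\<^sub>j)\<close> is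
  the same for \<open>\<rho>\<close> and \<open>g\<close>, so its value plays no role.
\<close>

subsection \<open>Functions of class \<open>C\<^sup>k\<close>\<close>

text \<open>Let w solve H w = \<partial>\<rho>. For each j, column j of H consists of the
  z-derivatives of the j-th conjugate derivative of \<rho>; replace it by the z-derivatives of h(r)
  times that function. The new determinant still integrates to 0, and Cramer's rule evaluates it as
  (h(r) - h'(r) cnj(\<rho>_j) w_j) det H. Summing over j produces the factor n in front of h and the
  sum q of cnj(\<rho>_j) w_j in front of h'. The obstacle is that r powr \<beta> has no compact
  support and that none of the integrals is known to be finite. The truncations are therefore chosen
  so that h and h' are both nonnegative and both increase to their limits. Monotone convergence then
  carries the identity over to values in [0, \<infinity>], and finiteness is decided only at the
  end, from explicit positive constants. The bound \<alpha> > n/2 says \<beta> > 0: r powr \<beta>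
  tends to 0 with r, so cutting off its small values gives functions that vanish near 0.\<close>

lemma has_derivative_cong_open:
  assumes "open S" "x \<in> S" "\<And>y. y \<in> S \<Longrightarrow> f y = g y"
  shows "(f has_derivative f') (at x) \<longleftrightarrow> (g has_derivative f') (at x)"
  using assms has_derivative_transform_within_open[of f f' x UNIV S g]
    has_derivative_transform_within_open[of g f' x UNIV S f] by auto

lemma frechet_derivative_cong_open:
  assumes "open S" "x \<in> S" "\<And>y. y \<in> S \<Longrightarrow> f y = g y"
  shows "frechet_derivative f (at x) = frechet_derivative g (at x)"
  unfolding frechet_derivative_def by (simp add: has_derivative_cong_open[OF assms])

lemma differentiable_cong_open:
  assumes "open S" "x \<in> S" "\<And>y. y \<in> S \<Longrightarrow> f y = g y"
  shows "f differentiable (at x) \<longleftrightarrow> g differentiable (at x)"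
  unfolding differentiable_def by (simp add: has_derivative_cong_open[OF assms])

lemma frechet_derivative_eqI:
  "(f has_derivative f') (at x) \<Longrightarrow> frechet_derivative f (at x) v = f' v"
  using frechet_derivative_at by metis

lemma Ck_on_cong:
  assumes "open S" "\<And>x. x \<in> S \<Longrightarrow> f x = g x"
  shows "Ck_on k S f \<longleftrightarrow> Ck_on k S g"
  using assms(2)
proof (induction k arbitrary: f g)
  case 0
  then show ?case by (simp cong: continuous_on_cong)
next
  case (Suc k)
  have "frechet_derivative f (at x) = frechet_derivative g (at x)"
    "f differentiable (at x) \<longleftrightarrow> g differentiable (at x)" if "x \<in> S" for x
    using frechet_derivative_cong_open[OF assms(1) that, of f g]
      differentiable_cong_open[OF assms(1) that, of f g] Suc.prems by auto
  then show ?case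
    using Suc.IH[of "\<lambda>x. frechet_derivative f (at x) v" "\<lambda>x. frechet_derivative g (at x) v" for v]
    by simp
qed

text \<open>\<open>Ck_on\<close> recurses on \<open>frechet_derivative\<close>, a
  \<open>SOME\<close> choice. By uniqueness of derivatives any explicit family may take its place,
  and the closure rules below induct through this rule.\<close>

lemma Ck_on_Suc_I:
  assumes "open S" "\<And>x. x \<in> S \<Longrightarrow> (f has_derivative f' x) (at x)"
    "\<And>v. Ck_on k S (\<lambda>x. f' x v)"
  shows "Ck_on (Suc k) S f"
proof -
  have "Ck_on k S (\<lambda>x. frechet_derivative f (at x) v)" for v
    using assms(3)[of v] Ck_on_cong[OF assms(1), of "\<lambda>x. frechet_derivative f (at x) v" "\<lambda>x. f' x v"]
      frechet_derivative_eqI[OF assms(2)] by blast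
  then show ?thesis using assms(2) by (auto simp: differentiable_def)
qed

lemma Ck_on_Suc_D: "Ck_on (Suc k) S f \<Longrightarrow> Ck_on k S f"
proof (induction k arbitrary: f)
  case 0
  then have "\<forall>x\<in>S. f differentiable (at x)" by simp
  then have "f differentiable_on S"
    unfolding differentiable_on_def using differentiable_at_withinI by blast
  then show ?case by (simp add: differentiable_imp_continuous_on)
next
  case (Suc k)
  then show ?case by (metis Ck_on.simps(2))
qed

lemma Ck_on_has_derivative:
  "Ck_on (Suc k) S f \<Longrightarrow> x \<in> S \<Longrightarrow> (f has_derivative frechet_derivative f (at x)) (at x)"
  by (simp add: frechet_derivative_works)

lemma Ck_on_imp_continuous_on: "Ck_on k S f \<Longrightarrow> continuous_on S f"
  by (induction k) (simp, blast dest: Ck_on_Suc_D)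

lemma Ck_on_const: "open S \<Longrightarrow> Ck_on k S (\<lambda>x. c)"
proof (induction k arbitrary: c)
  case (Suc k)
  then show ?case by (intro Ck_on_Suc_I[where f' = "\<lambda>_ _. 0"]) auto
qed simp

lemma Ck_on_bounded_linear:
  assumes "open S" "bounded_linear h" "Ck_on k S f"
  shows "Ck_on k S (\<lambda>x. h (f x))"
  using assms(3)
proof (induction k arbitrary: f)
  case 0
  then show ?case using assms(2) by (simp add: bounded_linear.continuous_on)
next
  case (Suc k)
  show ?case
    by (rule Ck_on_Suc_I[OF assms(1) bounded_linear.has_derivative[OF assms(2) Ck_on_has_derivative[OF Suc.prems]]])
      (use Suc in auto)
qed

lemma Ck_on_add:
  assumes "open S" "Ck_on k S f" "Ck_on k S g"
  shows "Ck_on k S (\<lambda>x. f x + g x)"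
  using assms(2,3)
proof (induction k arbitrary: f g)
  case (Suc k)
  show ?case
    by (rule Ck_on_Suc_I[OF assms(1) has_derivative_add[OF Ck_on_has_derivative[OF Suc.prems(1)] Ck_on_has_derivative[OF Suc.prems(2)]]])
      (use Suc in auto)
qed (simp add: continuous_on_add)

lemma Ck_on_mult:
  fixes f g :: "'a::real_normed_vector \<Rightarrow> 'b::real_normed_algebra"
  assumes "open S" "Ck_on k S f" "Ck_on k S g"
  shows "Ck_on k S (\<lambda>x. f x * g x)"
  using assms(2,3)
proof (induction k arbitrary: f g)
  case (Suc k)
  show ?case
    by (rule Ck_on_Suc_I[OF assms(1) has_derivative_mult[OF Ck_on_has_derivative[OF Suc.prems(1)] Ck_on_has_derivative[OF Suc.prems(2)]]])
      (use Suc Ck_on_Suc_D[OF Suc.prems(1)] Ck_on_Suc_D[OF Suc.prems(2)] in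
        \<open>auto intro!: Ck_on_add[OF assms(1)]\<close>)
qed (simp add: continuous_on_mult)

lemma Ck_on_prod:
  fixes f :: "'i \<Rightarrow> 'a::real_normed_vector \<Rightarrow> 'b::real_normed_field"
  assumes "open S" "\<And>i. i \<in> I \<Longrightarrow> Ck_on k S (f i)"
  shows "Ck_on k S (\<lambda>x. \<Prod>i\<in>I. f i x)"
  using assms(2)
  by (induction I rule: infinite_finite_induct) (auto intro!: Ck_on_const Ck_on_mult assms(1))

text \<open>The exponent is generalised in the induction, since differentiating lowers it by
  one.\<close>

lemma Ck_on_powr:
  fixes u :: "'a::real_normed_vector \<Rightarrow> real"
  assumes "open S" "Ck_on k S u" "\<And>x. x \<in> S \<Longrightarrow> u x > 0"
  shows "Ck_on k S (\<lambda>x. u x powr a)"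
  using assms(2)
proof (induction k arbitrary: a)
  case 0
  then show ?case using assms(3) by (force intro!: continuous_on_powr continuous_on_const)
next
  case (Suc k)
  show ?case
  proof (rule Ck_on_Suc_I[OF assms(1)])
    fix x assume x: "x \<in> S"
    have "((\<lambda>t. t powr a) has_derivative (*) (a * u x powr (a - 1))) (at (u x))"
      using has_real_derivative_powr[of "u x" a] assms(3)[OF x] by (simp add: has_field_derivative_def)
    then show "((\<lambda>x. u x powr a) has_derivative
        (\<lambda>v. a * u x powr (a - 1) * frechet_derivative u (at x) v)) (at x)"
      using has_derivative_compose[OF Ck_on_has_derivative[OF Suc.prems x]] by blast
  next
    fix v
    show "Ck_on k S (\<lambda>x. a * u x powr (a - 1) * frechet_derivative u (at x) v)"
      by (intro Ck_on_mult assms(1) Ck_on_const Suc.IH)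
        (use Suc.prems Ck_on_Suc_D in auto)
  qed
qed

text \<open>Only C^1 is claimed, because the derivative of the truncated powers to which this is
  applied has a corner.\<close>

lemma C1_on_compose_real:
  fixes u :: "'a::real_normed_vector \<Rightarrow> real" and h :: "real \<Rightarrow> real"
  assumes "open S" "Ck_on 1 S u" "\<And>x. x \<in> S \<Longrightarrow> u x > 0"
    and "\<And>t. t > 0 \<Longrightarrow> (h has_real_derivative h' t) (at t)" "continuous_on {0<..} h'"
  shows "Ck_on 1 S (\<lambda>x. h (u x))"
proof -
  have u: "Ck_on (Suc 0) S u" using assms(2) by simp
  have c: "continuous_on S (\<lambda>x. h' (u x))"
    by (rule continuous_on_compose2[OF assms(5) Ck_on_imp_continuous_on[OF assms(2)]])
      (use assms(3) in auto)
  have "Ck_on (Suc 0) S (\<lambda>x. h (u x))"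
  proof (rule Ck_on_Suc_I[OF assms(1)])
    fix x assume x: "x \<in> S"
    have "(h has_derivative (*) (h' (u x))) (at (u x))"
      using assms(3,4) x by (simp add: has_field_derivative_def)
    then show "((\<lambda>x. h (u x)) has_derivative (\<lambda>v. h' (u x) * frechet_derivative u (at x) v)) (at x)"
      using has_derivative_compose[OF Ck_on_has_derivative[OF u x]] by blast
  qed (use c u in \<open>auto intro!: continuous_on_mult\<close>)
  then show ?thesis by simp
qed

text \<open>Both iterated derivatives are the limit of the same second-order difference quotient.\<close>

lemma second_difference_mean_value:
  fixes f :: "'a::real_normed_vector \<Rightarrow> real"
  assumes f: "Ck_on (Suc (Suc 0)) S f" and t: "t > 0"
    and S: "\<And>a b. 0 \<le> a \<Longrightarrow> a \<le> t \<Longrightarrow> 0 \<le> b \<Longrightarrow> b \<le> t \<Longrightarrow> x + a *\<^sub>R v + b *\<^sub>R w \<in> S"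
  obtains a b where "0 \<le> a" "a \<le> t" "0 \<le> b" "b \<le> t"
    "f (x + t *\<^sub>R v + t *\<^sub>R w) - f (x + t *\<^sub>R v) - f (x + t *\<^sub>R w) + f x =
     t\<^sup>2 * frechet_derivative (\<lambda>y. frechet_derivative f (at y) v) (at (x + a *\<^sub>R v + b *\<^sub>R w)) w"
proof -
  let ?d = "\<lambda>y. frechet_derivative f (at y) v"
  have d: "Ck_on (Suc 0) S ?d" using f by simp
  have der: "((\<lambda>a. f (x + a *\<^sub>R v + b *\<^sub>R w)) has_real_derivative ?d (x + a *\<^sub>R v + b *\<^sub>R w)) (at a)"
    if "0 \<le> a" "a \<le> t" "0 \<le> b" "b \<le> t" for a b
  proof -
    have "((\<lambda>a. x + a *\<^sub>R v + b *\<^sub>R w) has_derivative (\<lambda>h. h *\<^sub>R v)) (at a)"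
      by (auto intro!: derivative_eq_intros)
    from has_derivative_compose[OF this Ck_on_has_derivative[OF f S[OF that]]]
    show ?thesis
      using f S[OF that]
      by (simp add: has_field_derivative_def mult_commute_abs
          linear_cmul[OF linear_frechet_derivative])
  qed
  have der2: "((\<lambda>b. ?d (x + a *\<^sub>R v + b *\<^sub>R w)) has_real_derivative
      frechet_derivative ?d (at (x + a *\<^sub>R v + b *\<^sub>R w)) w) (at b)"
    if "0 \<le> a" "a \<le> t" "0 \<le> b" "b \<le> t" for a b
  proof -
    have "((\<lambda>b. x + a *\<^sub>R v + b *\<^sub>R w) has_derivative (\<lambda>h. h *\<^sub>R w)) (at b)"
      by (auto intro!: derivative_eq_intros)
    from has_derivative_compose[OF this Ck_on_has_derivative[OF d S[OF that]]]
    show ?thesis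
      using d S[OF that]
      by (simp add: has_field_derivative_def mult_commute_abs
          linear_cmul[OF linear_frechet_derivative])
  qed
  \<comment> \<open>The mean value theorem in direction \<open>v\<close> is applied to the increment
    of \<open>f\<close> in direction \<open>w\<close>; a second one, in direction \<open>w\<close>,
    then resolves the increment of the first derivative.\<close>
  have "\<exists>a>0. a < t \<and>
    (f (x + t *\<^sub>R v + t *\<^sub>R w) - f (x + t *\<^sub>R v)) - (f (x + 0 *\<^sub>R v + t *\<^sub>R w) - f (x + 0 *\<^sub>R v)) =
     (t - 0) * (?d (x + a *\<^sub>R v + t *\<^sub>R w) - ?d (x + a *\<^sub>R v))"
  proof (rule MVT2[OF t])
    fix a assume "0 \<le> a" "a \<le> t"
    then show "((\<lambda>a. f (x + a *\<^sub>R v + t *\<^sub>R w) - f (x + a *\<^sub>R v)) has_real_derivative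
        ?d (x + a *\<^sub>R v + t *\<^sub>R w) - ?d (x + a *\<^sub>R v)) (at a)"
      using DERIV_diff[OF der[of a t] der[of a 0]] t by simp
  qed
  then obtain a where a: "0 < a" "a < t"
    "(f (x + t *\<^sub>R v + t *\<^sub>R w) - f (x + t *\<^sub>R v)) - (f (x + 0 *\<^sub>R v + t *\<^sub>R w) - f (x + 0 *\<^sub>R v)) =
     (t - 0) * (?d (x + a *\<^sub>R v + t *\<^sub>R w) - ?d (x + a *\<^sub>R v))"
    by blast
  have "\<exists>b>0. b < t \<and> ?d (x + a *\<^sub>R v + t *\<^sub>R w) - ?d (x + a *\<^sub>R v + 0 *\<^sub>R w) =
     (t - 0) * frechet_derivative ?d (at (x + a *\<^sub>R v + b *\<^sub>R w)) w"
    using a by (intro MVT2[OF t] der2) auto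
  then obtain b where b: "0 < b" "b < t"
    "?d (x + a *\<^sub>R v + t *\<^sub>R w) - ?d (x + a *\<^sub>R v + 0 *\<^sub>R w) =
     (t - 0) * frechet_derivative ?d (at (x + a *\<^sub>R v + b *\<^sub>R w)) w"
    by blast
  show thesis
    by (rule that[of a b]) (use a b in \<open>auto simp: power2_eq_square algebra_simps\<close>)
qed

lemma frechet_derivative_commute_real:
  fixes f :: "'a::real_normed_vector \<Rightarrow> real"
  assumes S: "open S" "x \<in> S" and f: "Ck_on (Suc (Suc 0)) S f"
  shows "frechet_derivative (\<lambda>y. frechet_derivative f (at y) v) (at x) w =
         frechet_derivative (\<lambda>y. frechet_derivative f (at y) w) (at x) v"
proof -
  define P where "P v w y = frechet_derivative (\<lambda>y. frechet_derivative f (at y) v) (at y) w" for v w y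
  have cont: "continuous (at x) (P v w)" for v w
    using f S unfolding P_def by (simp add: continuous_on_eq_continuous_at)
  have "P v w x = P w v x"
  proof (rule ccontr)
    \<comment> \<open>Close to \<open>x\<close> each mixed derivative is within \<open>e\<close> of
      its value at \<open>x\<close>, yet at two suitable points they coincide; so the values at
      \<open>x\<close> differ by less than \<open>2 * e\<close>, which is their distance.\<close>
    define e where "e = \<bar>P v w x - P w v x\<bar> / 2"
    assume "P v w x \<noteq> P w v x"
    then have e: "e > 0" by (simp add: e_def)
    obtain d1 where d1: "d1 > 0" "\<And>y. dist y x < d1 \<Longrightarrow> dist (P v w y) (P v w x) < e"
      using cont[of v w] e unfolding continuous_at_eps_delta by metis
    obtain d2 where d2: "d2 > 0" "\<And>y. dist y x < d2 \<Longrightarrow> dist (P w v y) (P w v x) < e"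
      using cont[of w v] e unfolding continuous_at_eps_delta by metis
    obtain d3 where d3: "d3 > 0" "ball x d3 \<subseteq> S" using S openE by blast
    define d where "d = min d1 (min d2 d3)"
    have d: "d > 0" using d1 d2 d3 by (simp add: d_def)
    \<comment> \<open>The parallelogram with sides \<open>t *\<^sub>R v\<close> and
      \<open>t *\<^sub>R w\<close> then lies in the ball of radius \<open>d\<close>; the summand 1
      keeps the denominator positive when both vectors are 0.\<close>
    define t where "t = d / 2 / (norm v + norm w + 1)"
    have nn: "norm v + norm w + 1 > 0" by (smt (verit) norm_ge_zero)
    have t: "t > 0" using d nn by (simp add: t_def)
    \<comment> \<open>The primed vectors will be \<open>v\<close>, \<open>w\<close> in either order,
      since the two mean value arguments traverse the parallelogram differently.\<close>
    have near: "dist (x + a *\<^sub>R v' + b *\<^sub>R w') x < d"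
      if "0 \<le> a" "a \<le> t" "0 \<le> b" "b \<le> t" "norm v' + norm w' = norm v + norm w" for a b v' w'
    proof -
      have "dist (x + a *\<^sub>R v' + b *\<^sub>R w') x = norm (a *\<^sub>R v' + b *\<^sub>R w')"
        by (simp add: dist_norm algebra_simps)
      also have "\<dots> \<le> a * norm v' + b * norm w'"
        using norm_triangle_ineq[of "a *\<^sub>R v'" "b *\<^sub>R w'"] that by simp
      also have "\<dots> \<le> t * norm v' + t * norm w'"
        using that by (intro add_mono mult_right_mono) auto
      also have "\<dots> = t * (norm v + norm w)" by (simp add: that(5)[symmetric] algebra_simps)
      also have "\<dots> < t * (norm v + norm w + 1)" using t by simp
      also have "\<dots> = d / 2" using nn unfolding t_def by (intro nonzero_eq_divide_eq[THEN iffD1]) auto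
      also have "\<dots> < d" using d by simp
      finally show ?thesis .
    qed
    have inS: "x + a *\<^sub>R v' + b *\<^sub>R w' \<in> S"
      if "0 \<le> a" "a \<le> t" "0 \<le> b" "b \<le> t" "norm v' + norm w' = norm v + norm w" for a b v' w'
      using near[OF that] d3 by (auto simp: d_def dist_commute)
    obtain a b where ab: "0 \<le> a" "a \<le> t" "0 \<le> b" "b \<le> t"
      "f (x + t *\<^sub>R v + t *\<^sub>R w) - f (x + t *\<^sub>R v) - f (x + t *\<^sub>R w) + f x =
       t\<^sup>2 * P v w (x + a *\<^sub>R v + b *\<^sub>R w)"
      using second_difference_mean_value[OF f t inS, of v w thesis] unfolding P_def by auto
    obtain a' b' where ab': "0 \<le> a'" "a' \<le> t" "0 \<le> b'" "b' \<le> t"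
      "f (x + t *\<^sub>R w + t *\<^sub>R v) - f (x + t *\<^sub>R w) - f (x + t *\<^sub>R v) + f x =
       t\<^sup>2 * P w v (x + a' *\<^sub>R w + b' *\<^sub>R v)"
      using second_difference_mean_value[OF f t inS, of w v thesis] unfolding P_def by auto
    have "t\<^sup>2 * P v w (x + a *\<^sub>R v + b *\<^sub>R w) = t\<^sup>2 * P w v (x + a' *\<^sub>R w + b' *\<^sub>R v)"
      using ab(5) ab'(5) by (simp add: algebra_simps)
    then have "P v w (x + a *\<^sub>R v + b *\<^sub>R w) = P w v (x + a' *\<^sub>R w + b' *\<^sub>R v)"
      using t by simp
    moreover have "dist (P v w (x + a *\<^sub>R v + b *\<^sub>R w)) (P v w x) < e"
      using near[OF ab(1-4)] by (intro d1) (auto simp: d_def)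
    moreover have "dist (P w v (x + a' *\<^sub>R w + b' *\<^sub>R v)) (P w v x) < e"
      using near[OF ab'(1-4)] by (intro d2) (auto simp: d_def)
    ultimately show False unfolding e_def dist_real_def by (simp add: abs_if split: if_splits)
  qed
  then show ?thesis by (simp add: P_def)
qed

lemma frechet_derivative_bounded_linear:
  assumes "bounded_linear h" "f differentiable (at x)"
  shows "frechet_derivative (\<lambda>y. h (f y)) (at x) v = h (frechet_derivative f (at x) v)"
  using bounded_linear.has_derivative[OF assms(1)] assms(2) frechet_derivative_eqI
  by (metis frechet_derivative_works)

text \<open>Intermediate points exist only for real-valued functions, hence the passage to
  components.\<close>

lemma frechet_derivative_commute:
  fixes f :: "'a::real_normed_vector \<Rightarrow> 'b::euclidean_space"
  assumes S: "open S" "x \<in> S" and f: "Ck_on (Suc (Suc 0)) S f"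
  shows "frechet_derivative (\<lambda>y. frechet_derivative f (at y) v) (at x) w =
         frechet_derivative (\<lambda>y. frechet_derivative f (at y) w) (at x) v"
proof (rule euclidean_eqI)
  fix b :: 'b
  have bl: "bounded_linear (\<lambda>y. y \<bullet> b)" by (rule bounded_linear_inner_left)
  have *: "frechet_derivative (\<lambda>y. frechet_derivative f (at y) v) (at x) w \<bullet> b =
    frechet_derivative (\<lambda>y. frechet_derivative (\<lambda>y. f y \<bullet> b) (at y) v) (at x) w" for v w
  proof -
    have "frechet_derivative (\<lambda>y. frechet_derivative f (at y) v) (at x) w \<bullet> b =
      frechet_derivative (\<lambda>y. frechet_derivative f (at y) v \<bullet> b) (at x) w"
      using f S by (intro frechet_derivative_bounded_linear[OF bl, symmetric]) simp
    also have "frechet_derivative (\<lambda>y. frechet_derivative f (at y) v \<bullet> b) (at x) =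
      frechet_derivative (\<lambda>y. frechet_derivative (\<lambda>y. f y \<bullet> b) (at y) v) (at x)"
      using f
      by (intro frechet_derivative_cong_open[OF S] frechet_derivative_bounded_linear[OF bl, symmetric]) simp
    finally show ?thesis .
  qed
  show "frechet_derivative (\<lambda>y. frechet_derivative f (at y) v) (at x) w \<bullet> b =
         frechet_derivative (\<lambda>y. frechet_derivative f (at y) w) (at x) v \<bullet> b"
    unfolding * by (rule frechet_derivative_commute_real[OF S Ck_on_bounded_linear[OF S(1) bl f]])
qed

subsection \<open>Integrals of derivatives with compact support\<close>

text \<open>This supplies the dominating function for difference quotients in direction
  \<open>v\<close>. Only that directional derivative is bounded, so the mean value inequality is
  applied along the line.\<close>

lemma has_derivative_line_increment_bound:
  fixes f :: "'a::real_normed_vector \<Rightarrow> 'b::real_normed_vector"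
  assumes der: "\<And>x. f differentiable (at x)"
    and bd: "\<And>x. norm (frechet_derivative f (at x) v) \<le> B"
  shows "norm (f (x + t *\<^sub>R v) - f x) \<le> B * \<bar>t\<bar>"
proof -
  have *: "((\<lambda>s. f (x + s *\<^sub>R v)) has_derivative
      (\<lambda>h. h *\<^sub>R frechet_derivative f (at (x + s *\<^sub>R v)) v)) (at s within UNIV)" for s
  proof -
    have "((\<lambda>s. x + s *\<^sub>R v) has_derivative (\<lambda>h. h *\<^sub>R v)) (at s)"
      by (auto intro!: derivative_eq_intros)
    from has_derivative_compose[OF this der[unfolded frechet_derivative_works]]
    show ?thesis
      unfolding linear_cmul[OF linear_frechet_derivative[OF der]] by simp
  qed
  have "onorm (\<lambda>h. h *\<^sub>R frechet_derivative f (at (x + s *\<^sub>R v)) v) \<le> B" for s :: real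
  proof (rule onorm_le)
    fix h :: real
    show "norm (h *\<^sub>R frechet_derivative f (at (x + s *\<^sub>R v)) v) \<le> B * norm h"
      using mult_left_mono[OF bd[of "x + s *\<^sub>R v"] abs_ge_zero[of h]] by (metis mult.commute norm_scaleR real_norm_def)
  qed
  from differentiable_bound[OF convex_UNIV * this UNIV_I UNIV_I, of t 0] show ?thesis by simp
qed

lemma integrable_compact_support:
  fixes g :: "'a::euclidean_space \<Rightarrow> 'b::euclidean_space"
  assumes "compact K" "continuous_on K g" "\<And>x. x \<notin> K \<Longrightarrow> g x = 0"
  shows "integrable lborel g"
proof -
  have "integrable lborel (\<lambda>x. indicator K x *\<^sub>R g x)"
    using assms by (intro borel_integrable_compact)
  moreover have "(\<lambda>x. indicator K x *\<^sub>R g x) = g"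
    using assms(3) by (auto simp: indicator_def)
  ultimately show ?thesis by simp
qed

text \<open>The integral of a difference quotient vanishes by translation invariance.\<close>

lemma integral_frechet_derivative_compact_support:
  fixes f :: "'a::euclidean_space \<Rightarrow> complex"
  assumes S: "open S" "compact K" "K \<subseteq> S"
    and f: "Ck_on 1 S f" and f0: "\<And>x. x \<notin> K \<Longrightarrow> f x = 0"
  shows "integrable lborel (\<lambda>x. frechet_derivative f (at x) v)"
    and "(LINT x|lborel. frechet_derivative f (at x) v) = 0"
proof -
  let ?D = "\<lambda>x. frechet_derivative f (at x) v"
  have opK: "open (- K)" using S compact_imp_closed by auto
  \<comment> \<open>The complement of \<open>K\<close> is open and \<open>f\<close> vanishes there;
    together with \<open>S\<close> it covers the space, so \<open>f\<close> is C^1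
    everywhere.\<close>
  have off: "f differentiable (at x)" "?D x = 0" if "x \<notin> K" for x
  proof -
    have "(f has_derivative (\<lambda>_. 0)) (at x)"
      using has_derivative_cong_open[of "- K" x f "\<lambda>_. 0" "\<lambda>_. 0"] opK that f0 by auto
    then show "f differentiable (at x)" "?D x = 0"
      by (auto simp: differentiable_def frechet_derivative_eqI)
  qed
  have der: "f differentiable (at x)" for x
    using off f S by (cases "x \<in> K") auto
  have contf: "continuous_on UNIV f"
    using der by (simp add: continuous_on_eq_continuous_within differentiable_imp_continuous_within)
  have contD: "continuous_on UNIV ?D"
  proof -
    have "continuous_on S ?D" using f by simp
    moreover have "continuous_on (- K) ?D"
      using off(2) by (subst continuous_on_cong[of _ _ _ "\<lambda>_. 0"]) auto
    ultimately have "continuous_on (S \<union> - K) ?D"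
      using S opK by (intro continuous_on_open_Un)
    moreover have "S \<union> - K = UNIV" using S by auto
    ultimately show ?thesis by simp
  qed
  have "bounded (?D ` K)"
    using contD S by (intro compact_imp_bounded compact_continuous_image) (auto intro: continuous_on_subset)
  then obtain B where B: "B > 0" "\<And>x. x \<in> K \<Longrightarrow> norm (?D x) \<le> B"
    unfolding bounded_pos by auto
  have bd: "norm (?D x) \<le> B" for x
    using B off by (cases "x \<in> K") auto
  have intg: "integrable lborel g" if "continuous_on UNIV g" "\<And>x. x \<notin> K \<Longrightarrow> g x = 0" for g :: "'a \<Rightarrow> complex"
    using integrable_compact_support[OF S(2) continuous_on_subset[OF that(1) subset_UNIV] that(2)] .
  show "integrable lborel ?D" by (rule intg[OF contD off(2)])
  define q where "q n x = (f (x + (1 / real (Suc n)) *\<^sub>R v) - f x) /\<^sub>R (1 / real (Suc n))" for n x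
  \<comment> \<open>One compact set carrying all difference quotients: \<open>q n x\<close> can be
    nonzero only if \<open>x\<close> or \<open>x\<close> moved by at most one \<open>v\<close> lies
    in \<open>K\<close>.\<close>
  define L where "L = {x + s *\<^sub>R v | x s. x \<in> K \<and> s \<in> {-1..0}}"
  have compL: "compact L"
  proof -
    have "compact ((\<lambda>(x, s). x + s *\<^sub>R v) ` (K \<times> {-1..0::real}))"
      using S by (intro compact_continuous_image compact_Times)
        (auto simp: case_prod_beta intro!: continuous_intros)
    moreover have "(\<lambda>(x, s). x + s *\<^sub>R v) ` (K \<times> {-1..0}) = L" by (force simp: L_def)
    ultimately show ?thesis by simp
  qed
  have inL: "y + s *\<^sub>R v \<in> L" if "y \<in> K" "-1 \<le> s" "s \<le> 0" for y s
    unfolding L_def mem_Collect_eq using that by (intro exI[of _ y] exI[of _ s]) simp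
  have q0: "q n x = 0" if "x \<notin> L" for n x
  proof -
    have "x \<notin> K"
    proof
      assume "x \<in> K"
      then have "x + 0 *\<^sub>R v \<in> L"
        by (intro inL) auto
      then show False using that by simp
    qed
    moreover have "x + (1 / real (Suc n)) *\<^sub>R v \<notin> K"
    proof
      assume "x + (1 / real (Suc n)) *\<^sub>R v \<in> K"
      then have "x + (1 / real (Suc n)) *\<^sub>R v + (- (1 / real (Suc n))) *\<^sub>R v \<in> L"
        by (intro inL) auto
      then show False using that by simp
    qed
    ultimately show ?thesis by (simp add: q_def f0)
  qed
  have qint: "(LINT x|lborel. q n x) = 0" for n
  proof -
    let ?t = "(1 / real (Suc n)) *\<^sub>R v"
    have fi: "integrable lborel f" by (rule intg[OF contf f0])
    have "integrable (distr lborel borel ((+) ?t)) f"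
      using fi by (simp add: lborel_distr_plus)
    then have fi2: "integrable lborel (\<lambda>x. f (?t + x))"
      using borel_measurable_continuous_onI[OF contf] by (subst (asm) integrable_distr_eq) auto
    have "(LINT x|lborel. f x) = (LINT x|distr lborel borel ((+) ?t). f x)"
      by (simp add: lborel_distr_plus)
    also have "\<dots> = (LINT x|lborel. f (?t + x))"
      using borel_measurable_continuous_onI[OF contf] by (intro integral_distr) auto
    finally have "(LINT x|lborel. f (?t + x) - f x) = 0"
      using Bochner_Integration.integral_diff[OF fi2 fi] by simp
    then show ?thesis
      unfolding q_def by (simp add: add.commute[of _ v] add.commute[of _ "_ *\<^sub>R v"])
  qed
  have "(\<lambda>n. LINT x|lborel. q n x) \<longlonglongrightarrow> (LINT x|lborel. ?D x)"
  proof (rule integral_dominated_convergence[where w = "\<lambda>x. indicator L x *\<^sub>R B"])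
    show "?D \<in> borel_measurable lborel"
      using borel_measurable_continuous_onI[OF contD] by simp
    show "q n \<in> borel_measurable lborel" for n
    proof -
      have "continuous_on UNIV (q n)"
        unfolding q_def by (intro continuous_intros continuous_on_compose2[OF contf]) auto
      from borel_measurable_continuous_onI[OF this] show ?thesis by simp
    qed
    show "integrable lborel (\<lambda>x. indicator L x *\<^sub>R B)"
      by (rule borel_integrable_compact[OF compL]) (rule continuous_on_const)
    show "AE x in lborel. norm (q n x) \<le> indicator L x *\<^sub>R B" for n
    proof (rule AE_I2)
      fix x
      show "norm (q n x) \<le> indicator L x *\<^sub>R B"
      proof (cases "x \<in> L")
        case True
        have "norm (f (x + (1 / real (Suc n)) *\<^sub>R v) - f x) \<le> B * \<bar>1 / real (Suc n)\<bar>"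
          by (rule has_derivative_line_increment_bound[OF der bd])
        then have "real (Suc n) * norm (f (x + (1 / real (Suc n)) *\<^sub>R v) - f x) \<le> B"
          by (simp add: field_simps)
        then show ?thesis using True by (simp add: q_def del: of_nat_Suc)
      qed (simp add: q0)
    qed
    show "AE x in lborel. (\<lambda>n. q n x) \<longlonglongrightarrow> ?D x"
    proof (rule AE_I2)
      fix x
      have "((\<lambda>s. x + s *\<^sub>R v) has_derivative (\<lambda>h. h *\<^sub>R v)) (at 0)"
        by (auto intro!: derivative_eq_intros)
      from has_derivative_compose[OF this, of f "frechet_derivative f (at x)"]
      have "((\<lambda>s. f (x + s *\<^sub>R v)) has_derivative (\<lambda>h. h *\<^sub>R ?D x)) (at 0)"
        using der by (simp add: frechet_derivative_works[symmetric] linear_cmul[OF linear_frechet_derivative])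
      then have lim0: "((\<lambda>s. norm (f (x + s *\<^sub>R v) - f x - s *\<^sub>R ?D x) / norm s) \<longlongrightarrow> 0) (at 0)"
        by (simp add: has_derivative_at)
      have eq: "norm (f (x + s *\<^sub>R v) - f x - s *\<^sub>R ?D x) / norm s =
          norm ((f (x + s *\<^sub>R v) - f x) /\<^sub>R s - ?D x)" if "s \<noteq> 0" for s
      proof -
        have "(f (x + s *\<^sub>R v) - f x) /\<^sub>R s - ?D x = (f (x + s *\<^sub>R v) - f x - s *\<^sub>R ?D x) /\<^sub>R s"
          using that by (simp add: scaleR_right_diff_distrib)
        then show ?thesis by (simp add: divide_inverse_commute)
      qed
      from lim0 have "((\<lambda>s. norm ((f (x + s *\<^sub>R v) - f x) /\<^sub>R s - ?D x)) \<longlongrightarrow> 0) (at 0)"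
        by (rule Lim_transform_eventually) (use eq in \<open>auto simp only: eventually_at_filter intro!: always_eventually\<close>)
      then have lim: "((\<lambda>s. (f (x + s *\<^sub>R v) - f x) /\<^sub>R s) \<longlongrightarrow> ?D x) (at 0)"
        by (simp add: tendsto_norm_zero_iff LIM_zero_iff)
      have "filterlim (\<lambda>n. 1 / real (Suc n)) (at 0) sequentially"
        by (rule filterlim_atI[OF LIMSEQ_Suc[OF lim_1_over_n]]) simp
      from filterlim_compose[OF lim this] show "(\<lambda>n. q n x) \<longlonglongrightarrow> ?D x"
        by (simp add: q_def)
    qed
  qed
  then show "(LINT x|lborel. ?D x) = 0"
    by (simp add: qint LIMSEQ_const_iff)
qed

section \<open>Calculus of Wirtinger derivatives\<close>

lemma dz_eq:
  assumes "(u has_derivative u') (at z)"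
  shows "dz i u z = (u' (axis i 1) - \<i> * u' (axis i \<i>)) / 2"
    and "dzbar i u z = (u' (axis i 1) + \<i> * u' (axis i \<i>)) / 2"
  using frechet_derivative_eqI[OF assms] by (simp_all add: dz_def dzbar_def)

lemma dz_cong_open:
  assumes "open S" "z \<in> S" "\<And>w. w \<in> S \<Longrightarrow> u w = v w"
  shows "dz i u z = dz i v z" "dzbar i u z = dzbar i v z"
  using frechet_derivative_cong_open[OF assms] by (simp_all add: dz_def dzbar_def)

lemma dz_const: "dz i (\<lambda>w. c) z = 0"
  using dz_eq(1)[of "\<lambda>w. c" "\<lambda>_. 0" z i] by simp

lemma dz_mult:
  assumes "u differentiable (at z)" "v differentiable (at z)"
  shows "dz i (\<lambda>w. u w * v w) z = dz i u z * v z + u z * dz i v z"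
  unfolding dz_eq(1)[OF has_derivative_mult[OF assms[unfolded frechet_derivative_works]]]
  unfolding dz_def by (simp add: field_simps)

lemma dz_prod:
  assumes "finite I" "\<And>l. l \<in> I \<Longrightarrow> u l differentiable (at z)"
  shows "(\<lambda>w. \<Prod>l\<in>I. u l w) differentiable (at z)"
    and "dz i (\<lambda>w. \<Prod>l\<in>I. u l w) z = (\<Sum>m\<in>I. dz i (u m) z * (\<Prod>l\<in>I - {m}. u l z))"
proof -
  have "(\<lambda>w. \<Prod>l\<in>I. u l w) differentiable (at z) \<and>
    dz i (\<lambda>w. \<Prod>l\<in>I. u l w) z = (\<Sum>m\<in>I. dz i (u m) z * (\<Prod>l\<in>I - {m}. u l z))"
    using assms
  proof (induction I rule: finite_induct)
    case empty
    then show ?case by (simp add: dz_const)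
  next
    case (insert k I)
    then have d: "u k differentiable (at z)" "(\<lambda>w. \<Prod>l\<in>I. u l w) differentiable (at z)" by auto
    have "(\<Sum>m\<in>I. dz i (u m) z * (\<Prod>l\<in>insert k I - {m}. u l z)) =
        (\<Sum>m\<in>I. u k z * (dz i (u m) z * (\<Prod>l\<in>I - {m}. u l z)))"
    proof (intro sum.cong refl)
      fix m assume "m \<in> I"
      then have "insert k I - {m} = insert k (I - {m})" using insert.hyps by auto
      then show "dz i (u m) z * (\<Prod>l\<in>insert k I - {m}. u l z) =
          u k z * (dz i (u m) z * (\<Prod>l\<in>I - {m}. u l z))"
        using insert.hyps by simp
    qed
    moreover have "insert k I - {k} = I" using insert.hyps by auto
    ultimately show ?case
      using insert d dz_mult[OF d, of i] differentiable_mult[OF d]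
      by (simp add: sum_distrib_left)
  qed
  then show "(\<lambda>w. \<Prod>l\<in>I. u l w) differentiable (at z)"
    "dz i (\<lambda>w. \<Prod>l\<in>I. u l w) z = (\<Sum>m\<in>I. dz i (u m) z * (\<Prod>l\<in>I - {m}. u l z))" by auto
qed

lemma Ck_on_dz:
  assumes "open S" "Ck_on (Suc k) S u"
  shows "Ck_on k S (dz i u)" "Ck_on k S (dzbar i u)"
proof -
  have "Ck_on k S (\<lambda>z. (1 / 2) * frechet_derivative u (at z) (axis i 1) +
      c * frechet_derivative u (at z) (axis i \<i>))" for c
    using assms by (intro Ck_on_add Ck_on_mult Ck_on_const) auto
  from this[of "- \<i> / 2"] this[of "\<i> / 2"]
  show "Ck_on k S (dz i u)" "Ck_on k S (dzbar i u)"
    unfolding dz_def dzbar_def by (simp_all add: diff_divide_distrib add_divide_distrib)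
qed

lemma dz_commute:
  assumes "open S" "z \<in> S" and u: "Ck_on (Suc (Suc 0)) S u"
  shows "dz i (dz j u) z = dz j (dz i u) z"
proof -
  define P where "P v w = frechet_derivative (\<lambda>y. frechet_derivative u (at y) v) (at z) w" for v w
  have P: "P v w = P w v" for v w
    unfolding P_def by (rule frechet_derivative_commute[OF assms])
  have *: "dz i (dz j u) z = ((P (axis j 1) (axis i 1) - \<i> * P (axis j \<i>) (axis i 1)) / 2 -
      \<i> * ((P (axis j 1) (axis i \<i>) - \<i> * P (axis j \<i>) (axis i \<i>)) / 2)) / 2" for i j
  proof (rule dz_eq)
    have d: "((\<lambda>y. frechet_derivative u (at y) v) has_derivative P v) (at z)" for v
      using u assms(2) unfolding P_def by (simp add: frechet_derivative_works)
    show "(dz j u has_derivative (\<lambda>w. (P (axis j 1) w - \<i> * P (axis j \<i>) w) / 2)) (at z)"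
      unfolding dz_def by (auto intro!: derivative_eq_intros d simp: field_simps)
  qed
  show ?thesis
    unfolding * P[of "axis i 1"] P[of "axis i \<i>"] by (simp add: field_simps)
qed

lemma integral_dz_compact_support:
  fixes u :: "complex ^ 'n \<Rightarrow> complex"
  assumes "open S" "compact K" "K \<subseteq> S" "Ck_on 1 S u" "\<And>z. z \<notin> K \<Longrightarrow> u z = 0"
  shows "integrable lborel (dz i u)" "(LINT z|lborel. dz i u z) = 0"
  using integral_frechet_derivative_compact_support[OF assms, of "axis i 1"]
    integral_frechet_derivative_compact_support[OF assms, of "axis i \<i>"]
  unfolding dz_def by simp_all

text \<open>The determinant is a null Lagrangian: it is a signed sum of derivatives of the functions
  \<open>\<phi> \<Prod>\<^bsub>l \<noteq> j\<^esub> \<partial>\<^bsub>p l\<^esub> F\<^sub>l\<close>, because the terms with second derivatives of some \<open>F\<^sub>m\<close> cancel in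
  pairs \<open>p, p \<circ> (j m)\<close>.\<close>

lemma integral_det_dz_compact_support:
  fixes \<phi> :: "complex ^ 'n \<Rightarrow> complex" and F :: "'n \<Rightarrow> complex ^ 'n \<Rightarrow> complex"
    and j :: 'n
  assumes S: "open S" "compact K" "K \<subseteq> S" and \<phi>: "Ck_on 1 S \<phi>" "\<And>z. z \<notin> K \<Longrightarrow> \<phi> z = 0"
    and F: "\<And>l. Ck_on (Suc (Suc 0)) S (F l)"
  defines "M \<equiv> (\<lambda>z. \<chi> i l. if l = j then dz i \<phi> z else dz i (F l) z)"
  shows "integrable lborel (\<lambda>z. det (M z))" "(LINT z|lborel. det (M z)) = 0"
    and "\<And>z. z \<notin> K \<Longrightarrow> det (M z) = 0"
proof -
  define \<psi> where "\<psi> p z = \<phi> z * (\<Prod>l\<in>UNIV - {j}. dz (p l) (F l) z)" for p :: "'n \<Rightarrow> 'n" and z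
  have F1: "Ck_on 1 S (dz i (F l))" for i l
    using Ck_on_dz(1)[OF S(1) F] by simp
  have \<psi>1: "Ck_on 1 S (\<psi> p)" for p
    unfolding \<psi>_def by (intro Ck_on_mult Ck_on_prod S(1) \<phi>(1) F1)
  have \<psi>0: "\<psi> p z = 0" if "z \<notin> K" for p z
    using \<phi>(2)[OF that] by (simp add: \<psi>_def)
  have off: "dz i u z = 0" if "z \<notin> K" "\<And>w. w \<notin> K \<Longrightarrow> u w = 0" for i z u
  proof -
    have "dz i u z = dz i (\<lambda>_. 0) z"
      using S(2) that by (intro dz_cong_open(1)[of "- K"]) (auto simp: compact_imp_closed)
    then show ?thesis by (simp add: dz_const)
  qed
  \<comment> \<open>Expanding the transpose lets a permutation \<open>p\<close> assign to each
    column \<open>l\<close> the direction \<open>p l\<close> in which its function is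
    differentiated.\<close>
  have det: "det (M z) = (\<Sum>p | p permutes UNIV. of_int (sign p) *
      (dz (p j) \<phi> z * (\<Prod>l\<in>UNIV - {j}. dz (p l) (F l) z)))" for z
  proof -
    have "(\<Prod>l\<in>UNIV. transpose (M z) $ l $ p l) = dz (p j) \<phi> z * (\<Prod>l\<in>UNIV - {j}. dz (p l) (F l) z)" for p
      by (subst prod.remove[of UNIV j]) (auto simp: M_def transpose_def intro!: prod.cong)
    moreover have "det (M z) = det (transpose (M z))" by simp
    ultimately show ?thesis unfolding det_def[of "transpose (M z)"] by simp
  qed
  show "det (M z) = 0" if "z \<notin> K" for z
    unfolding det using off[OF that \<phi>(2)] by simp
  have eq: "det (M z) = (\<Sum>p | p permutes UNIV. of_int (sign p) * dz (p j) (\<psi> p) z)" for z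
  proof (cases "z \<in> K")
    case False
    then show ?thesis
      unfolding det using off[OF False \<phi>(2)] off[OF False \<psi>0] by simp
  next
    case True
    then have z: "z \<in> S" using S by auto
    have diff: "dz i (F l) differentiable (at z)" "\<phi> differentiable (at z)" for i l
      using F1 \<phi>(1) z by auto
    \<comment> \<open>The term of the product rule in which the outer derivative, in direction
      \<open>p j\<close>, falls on the factor of column \<open>m\<close>. Exchanging
      \<open>p j\<close> and \<open>p m\<close> leaves it unchanged, as derivatives commute, but
      flips the sign of \<open>p\<close>.\<close>
    define T where "T m p = dz (p j) (dz (p m) (F m)) z * (\<Prod>l\<in>UNIV - {j} - {m}. dz (p l) (F l) z)"
      for m p
    have "dz (p j) (\<psi> p) z = dz (p j) \<phi> z * (\<Prod>l\<in>UNIV - {j}. dz (p l) (F l) z) +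
        \<phi> z * (\<Sum>m\<in>UNIV - {j}. T m p)" for p
    proof -
      have fin: "finite (UNIV - {j})" by simp
      note P = dz_prod[OF fin, of "\<lambda>l. dz (p l) (F l)", OF diff(1)]
      show ?thesis
        unfolding \<psi>_def T_def dz_mult[OF diff(2) P(1)] P(2) ..
    qed
    then have "(\<Sum>p | p permutes UNIV. of_int (sign p) * dz (p j) (\<psi> p) z) =
      det (M z) + (\<Sum>p | p permutes UNIV. \<Sum>m\<in>UNIV - {j}. \<phi> z * (of_int (sign p) * T m p))"
      unfolding det by (simp add: sum.distrib distrib_left sum_distrib_left mult.left_commute)
    also have "(\<Sum>p | p permutes UNIV. \<Sum>m\<in>UNIV - {j}. \<phi> z * (of_int (sign p) * T m p)) =
      (\<Sum>m\<in>UNIV - {j}. \<phi> z * (\<Sum>p | p permutes UNIV. of_int (sign p) * T m p))"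
      by (subst sum.swap) (simp add: sum_distrib_left)
    also have "\<dots> = 0"
    proof (rule sum.neutral, rule ballI)
      fix m assume "m \<in> UNIV - {j}"
      then have mj: "m \<noteq> j" by simp
      define \<tau> where "\<tau> = Transposition.transpose j m"
      have \<tau>: "\<tau> permutes UNIV" unfolding \<tau>_def by (rule permutes_swap_id) auto
      have "of_int (sign (p \<circ> \<tau>)) * T m (p \<circ> \<tau>) = - (of_int (sign p) * T m p)"
        if "p permutes UNIV" for p :: "'n \<Rightarrow> 'n"
      proof -
        have "permutation p" using that by (auto simp: permutation_permutes)
        then have "sign (p \<circ> \<tau>) = - sign p"
          using mj by (simp add: \<tau>_def sign_compose permutation_swap_id sign_swap_id)
        moreover have "(\<Prod>l\<in>UNIV - {j} - {m}. dz ((p \<circ> \<tau>) l) (F l) z) =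
            (\<Prod>l\<in>UNIV - {j} - {m}. dz (p l) (F l) z)"
          by (intro prod.cong refl) (auto simp: \<tau>_def transpose_apply_other)
        ultimately show ?thesis
          unfolding T_def using dz_commute[OF S(1) z F, of "p m" "p j" m]
          by (simp add: \<tau>_def)
      qed
      then have "(\<Sum>p | p permutes UNIV. of_int (sign p) * T m p) =
          (\<Sum>p | p permutes UNIV. - (of_int (sign p) * T m p))"
        by (subst sum_permutations_compose_right[OF \<tau>]) (auto intro!: sum.cong)
      then show "\<phi> z * (\<Sum>p | p permutes UNIV. of_int (sign p) * T m p) = 0"
        by (simp add: sum_negf)
    qed
    finally show ?thesis by simp
  qed
  note I = integral_dz_compact_support[OF S \<psi>1 \<psi>0]
  show "integrable lborel (\<lambda>z. det (M z))"
    unfolding eq using I(1) by (intro Bochner_Integration.integrable_sum integrable_mult_right)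
  show "(LINT z|lborel. det (M z)) = 0"
    unfolding eq using I by (subst Bochner_Integration.integral_sum) auto
qed

subsection \<open>Determinants, positive definite matrices and wedge powers\<close>

definition replace_column :: "'a ^ 'n ^ 'm \<Rightarrow> 'n \<Rightarrow> 'a ^ 'm \<Rightarrow> 'a ^ 'n ^ 'm" where
  "replace_column A j a = (\<chi> i l. if l = j then a $ i else A $ i $ l)"

text \<open>As \<open>b\<close> itself stands in row \<open>k\<close>, every other modified row
  comes from a row operation.\<close>

lemma det_add_multiples_to_fixed_row:
  fixes A :: "'a::{comm_ring_1}^'n^'n"
  assumes "finite S" "k \<notin> S"
  shows "det (\<chi> i. if i = k then b else if i \<in> S then A $ i + x i *s b else A $ i) =
         det (\<chi> i. if i = k then b else A $ i)"
  using assms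
proof (induction S rule: finite_induct)
  case empty
  show ?case by (simp cong: if_cong)
next
  case (insert m S)
  have "m \<noteq> k" "k \<notin> S" using insert.prems by auto
  define B where "B = (\<chi> i. if i = k then b else if i \<in> S then A $ i + x i *s b else A $ i)"
  have "(if i = k then b else if i \<in> insert m S then A $ i + x i *s b else A $ i) =
      (if i = m then row m B + x m *s row k B else row i B)" for i
    using insert.hyps \<open>m \<noteq> k\<close> by (simp add: row_def B_def)
  then have "det (\<chi> i. if i = k then b else if i \<in> insert m S then A $ i + x i *s b else A $ i) =
      det (\<chi> i. if i = m then row m B + x m *s row k B else row i B)"
    by presburger
  also have "\<dots> = det B"
    by (rule det_row_operation[OF \<open>m \<noteq> k\<close>])
  also have "\<dots> = det (\<chi> i. if i = k then b else A $ i)"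
    unfolding B_def by (rule insert.IH[OF \<open>k \<notin> S\<close>])
  finally show ?case .
qed

text \<open>Multilinearity in the rows. No terms of higher order in \<open>x\<close> survive,
  because they would contain the row \<open>b\<close> twice; the preceding lemma expresses
  this.\<close>

lemma det_add_multiples_to_rows:
  fixes A :: "'a::{comm_ring_1}^'n^'n"
  assumes "finite S"
  shows "det (\<chi> i. if i \<in> S then A $ i + x i *s b else A $ i) =
         det A + (\<Sum>i\<in>S. x i * det (\<chi> l. if l = i then b else A $ l))"
  using assms
proof (induction S rule: finite_induct)
  case empty
  then show ?case by simp
next
  case (insert k S)
  let ?c = "\<lambda>i. if i \<in> S then A $ i + x i *s b else A $ i"
  have "(if i \<in> insert k S then A $ i + x i *s b else A $ i) = (if i = k then A $ i + x k *s b else ?c i)" for i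
    by simp
  then have "det (\<chi> i. if i \<in> insert k S then A $ i + x i *s b else A $ i) =
      det (\<chi> i. if i = k then A $ i + x k *s b else ?c i)"
    by presburger
  also have "\<dots> = det (\<chi> i. if i = k then A $ i else ?c i) +
      det (\<chi> i. if i = k then x k *s b else ?c i)"
    by (rule det_row_add)
  also have "(\<chi> i. if i = k then A $ i else ?c i) = (\<chi> i. ?c i)"
    using insert.hyps by (auto simp: vec_eq_iff)
  also have "det (\<chi> i. if i = k then x k *s b else ?c i) = x k * det (\<chi> i. if i = k then b else ?c i)"
    by (rule det_row_mul)
  also have "det (\<chi> i. if i = k then b else ?c i) = det (\<chi> i. if i = k then b else A $ i)"
    using insert.hyps by (intro det_add_multiples_to_fixed_row)
  finally show ?case using insert by (simp add: algebra_simps)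
qed

lemma det_replace_column_solution:
  fixes A :: "'a::{field}^'n^'n"
  assumes "A *v w = a"
  shows "det (replace_column A j a) = w $ j * det A"
  unfolding replace_column_def assms[symmetric] by (rule cramer_lemma)

text \<open>The matrix determinant lemma, with a solution \<open>w\<close> in place of the inverse
  applied to \<open>a\<close>. The expansion is linear in \<open>b\<close>, and Cramer's rule
  evaluates each coefficient.\<close>

lemma det_rank_one_update:
  fixes A :: "'a::{field}^'n^'n"
  assumes "A *v w = a"
  shows "det (\<chi> i j. A $ i $ j + a $ i * b j) = det A * (1 + (\<Sum>j\<in>UNIV. b j * w $ j))"
proof -
  have "det (\<chi> i j. A $ i $ j + a $ i * b j) = det (transpose (\<chi> i j. A $ i $ j + a $ i * b j))"
    by simp
  also have "transpose (\<chi> i j. A $ i $ j + a $ i * b j) =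
      (\<chi> j. if j \<in> UNIV then transpose A $ j + b j *s a else transpose A $ j)"
    by (auto simp: vec_eq_iff transpose_def)
  also have "det \<dots> = det (transpose A) +
      (\<Sum>j\<in>UNIV. b j * det (\<chi> l. if l = j then a else transpose A $ l))"
    by (rule det_add_multiples_to_rows) simp
  also have "(\<Sum>j\<in>UNIV. b j * det (\<chi> l. if l = j then a else transpose A $ l)) =
      (\<Sum>j\<in>UNIV. b j * (w $ j * det A))"
  proof (intro sum.cong refl arg_cong2[where f = "(*)"])
    fix j
    have "(\<chi> l. if l = j then a else transpose A $ l) = transpose (replace_column A j a)"
      by (auto simp: vec_eq_iff transpose_def replace_column_def)
    then show "det (\<chi> l. if l = j then a else transpose A $ l) = w $ j * det A"
      using det_replace_column_solution[OF assms, of j] by simp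
  qed
  finally show ?thesis by (simp add: algebra_simps sum_distrib_left)
qed

text \<open>The part of the Sherman-Morrison formula needed here: the update maps the same
  \<open>w\<close> to a multiple of \<open>a\<close>, so solving with right-hand side
  \<open>a\<close> only rescales \<open>w\<close>.\<close>

lemma rank_one_update_solution:
  fixes A :: "'a::{field}^'n^'n"
  assumes "A *v w = a"
  shows "(\<chi> i j. A $ i $ j + a $ i * b j) *v w = (1 + (\<Sum>j\<in>UNIV. b j * w $ j)) *s a"
proof -
  have "(\<Sum>j\<in>UNIV. (A $ i $ j + a $ i * b j) * w $ j) = a $ i + a $ i * (\<Sum>j\<in>UNIV. b j * w $ j)" for i
    using arg_cong[OF assms, of "\<lambda>v. v $ i"]
    by (simp add: matrix_vector_mult_def distrib_right sum.distrib sum_distrib_left mult.assoc)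
  then show ?thesis by (simp add: vec_eq_iff matrix_vector_mult_def algebra_simps)
qed

lemma det_scaleR_matrix:
  fixes A :: "'a::{field}^'n^'n"
  shows "det (\<chi> i j. c * A $ i $ j) = c ^ CARD('n) * det A"
  using det_rows_mul[of "\<lambda>_. c" "\<lambda>i. A $ i"]
  by (simp add: vector_scalar_mult_def)

definition hermitian_form :: "complex^'n^'n \<Rightarrow> complex^'n \<Rightarrow> complex" where
  "hermitian_form A \<xi> = (\<Sum>i\<in>UNIV. \<Sum>j\<in>UNIV. A $ i $ j * \<xi> $ i * cnj (\<xi> $ j))"

lemma positive_definite_iff:
  "positive_definite A \<longleftrightarrow> (\<forall>\<xi>. \<xi> \<noteq> 0 \<longrightarrow> hermitian_form A \<xi> \<in> \<real> \<and> Re (hermitian_form A \<xi>) > 0)"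
  by (simp add: positive_definite_def hermitian_form_def)

lemma sum_mult_axis:
  fixes F :: "'n::finite \<Rightarrow> complex"
  shows "(\<Sum>j\<in>UNIV. F j * axis k s $ j) = F k * s"
    and "(\<Sum>j\<in>UNIV. F j * cnj (axis k s $ j)) = F k * cnj s"
proof -
  have "F j * axis k s $ j = (if j = k then F k * s else 0)"
    "F j * cnj (axis k s $ j) = (if j = k then F k * cnj s else 0)" for j
    by (simp_all add: axis_def)
  then show "(\<Sum>j\<in>UNIV. F j * axis k s $ j) = F k * s"
    "(\<Sum>j\<in>UNIV. F j * cnj (axis k s $ j)) = F k * cnj s"
    by simp_all
qed

lemma hermitian_form_axis: "hermitian_form A (axis k s) = A $ k $ k * s * cnj s"
  unfolding hermitian_form_def sum_mult_axis
  using sum_mult_axis(1)[of "\<lambda>i. A $ i $ k * cnj s" k s] by (simp add: mult_ac)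

lemma hermitian_form_axis2:
  "hermitian_form A (axis k s + axis l t) =
    A $ k $ k * s * cnj s + A $ k $ l * s * cnj t + A $ l $ k * t * cnj s + A $ l $ l * t * cnj t"
proof -
  let ?x = "axis k s + axis l t"
  have "hermitian_form A ?x = (\<Sum>i\<in>UNIV. (A $ i $ k * cnj s + A $ i $ l * cnj t) * ?x $ i)"
    unfolding hermitian_form_def vector_add_component complex_cnj_add distrib_left[of "_ * _"]
      sum.distrib sum_mult_axis
    by (simp add: algebra_simps sum.distrib)
  then show ?thesis
    unfolding vector_add_component distrib_left sum.distrib sum_mult_axis
    by (simp add: algebra_simps)
qed

text \<open>Polarisation: reality of the form at \<open>axis k 1 + axis l 1\<close> relates the
  imaginary parts of the two entries, and at \<open>axis k 1 + axis l \<i>\<close> their real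
  parts.\<close>

lemma positive_definite_hermitian:
  assumes "positive_definite A"
  shows "A $ l $ k = cnj (A $ k $ l)"
proof -
  have re: "hermitian_form A \<xi> \<in> \<real>" for \<xi>
    using assms by (cases "\<xi> = 0") (auto simp: positive_definite_iff hermitian_form_def)
  have d: "A $ m $ m \<in> \<real>" for m
    using re[of "axis m 1"] by (simp add: hermitian_form_axis)
  show ?thesis
  proof (cases "k = l")
    case True
    then show ?thesis using d by (simp add: Reals_cnj_iff)
  next
    case False
    have "Im (A $ k $ k) = 0" "Im (A $ l $ l) = 0"
      using d by (simp_all add: complex_is_Real_iff)
    moreover have "Im (hermitian_form A (axis k 1 + axis l 1)) = 0"
      "Im (hermitian_form A (axis k 1 + axis l \<i>)) = 0"
      using re by (simp_all only: complex_is_Real_iff)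
    moreover have "Im (hermitian_form A (axis k 1 + axis l 1)) =
        Im (A $ k $ k) + Im (A $ k $ l) + Im (A $ l $ k) + Im (A $ l $ l)"
      unfolding hermitian_form_axis2 by simp
    moreover have "Im (hermitian_form A (axis k 1 + axis l \<i>)) =
        Im (A $ k $ k) - Re (A $ k $ l) + Re (A $ l $ k) + Im (A $ l $ l)"
      unfolding hermitian_form_axis2 by simp
    ultimately have "Re (A $ l $ k) = Re (A $ k $ l)" "Im (A $ l $ k) = - Im (A $ k $ l)"
      by linarith+
    then show ?thesis by (simp add: complex_eq_iff)
  qed
qed

lemma positive_definite_det_nonzero:
  assumes "positive_definite A"
  shows "det A \<noteq> 0"
proof -
  have "x = 0" if "A *v x = 0" for x
  proof (rule ccontr)
    assume "x \<noteq> 0"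
    \<comment> \<open>The form pairs rows with \<open>\<xi>\<close> and columns with its conjugate,
      so conjugating \<open>x\<close> turns it into the product of the conjugate of \<open>x\<close>
      with \<open>A *v x\<close>.\<close>
    define \<xi> where "\<xi> = (\<chi> i. cnj (x $ i))"
    have nz: "\<xi> \<noteq> 0" using \<open>x \<noteq> 0\<close> by (auto simp: \<xi>_def vec_eq_iff)
    have "hermitian_form A \<xi> = (\<Sum>i\<in>UNIV. cnj (x $ i) * (A *v x) $ i)"
      by (simp add: hermitian_form_def \<xi>_def matrix_vector_mult_def sum_distrib_left mult_ac)
    moreover have "Re (hermitian_form A \<xi>) > 0"
      using assms \<open>\<xi> \<noteq> 0\<close> by (simp add: positive_definite_iff)
    ultimately show False using that by simp
  qed
  then show ?thesis
    using matrix_left_invertible_ker[of A] invertible_det_nz[of A] invertible_left_inverse[of A] by blast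
qed

lemma hermitian_det_real:
  fixes A :: "complex^'n^'n"
  assumes "\<And>k l. A $ l $ k = cnj (A $ k $ l)"
  shows "det A \<in> \<real>"
proof -
  have "cnj (det A) = det (transpose A)"
    unfolding det_def by (simp add: transpose_def assms[symmetric])
  then show ?thesis by (simp add: Reals_cnj_iff)
qed

lemma positive_definite_mat_1: "positive_definite (mat 1 :: complex^'n^'n)"
proof -
  have eq: "hermitian_form (mat 1) \<xi> = of_real (\<Sum>i\<in>UNIV. (cmod (\<xi> $ i))\<^sup>2)" for \<xi> :: "complex^'n"
  proof -
    have "mat 1 $ i $ j * \<xi> $ i * cnj (\<xi> $ j) = (if i = j then \<xi> $ i * cnj (\<xi> $ i) else 0)" for i j
      by (simp add: mat_def)
    then show ?thesis
      by (simp add: hermitian_form_def complex_norm_square[symmetric] del: of_real_power)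
  qed
  have "(\<Sum>i\<in>UNIV. (cmod (\<xi> $ i))\<^sup>2) > 0" if nz: "\<xi> \<noteq> 0" for \<xi> :: "complex^'n"
  proof -
    obtain k where "\<xi> $ k \<noteq> 0" using nz by (auto simp: vec_eq_iff)
    then show ?thesis by (intro sum_pos2[of _ k]) auto
  qed
  then show ?thesis by (simp add: positive_definite_iff eq)
qed

text \<open>On the segment from the identity to \<open>A\<close> the determinant is real and has no zero.\<close>

lemma positive_definite_det_pos:
  fixes A :: "complex^'n^'n"
  assumes "positive_definite A"
  shows "det A \<in> \<real>" "Re (det A) > 0"
proof -
  define B where "B t = (\<chi> i j. of_real (1 - t) * mat 1 $ i $ j + of_real t * A $ i $ j)" for t :: real
  have pd: "positive_definite (B t)" if "0 \<le> t" "t \<le> 1" for t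
  proof -
    have eq: "hermitian_form (B t) \<xi> =
        of_real (1 - t) * hermitian_form (mat 1) \<xi> + of_real t * hermitian_form A \<xi>" for \<xi>
      unfolding hermitian_form_def B_def sum_distrib_left sum.distrib[symmetric]
      by (intro sum.cong refl) (simp add: algebra_simps)
    show ?thesis
      unfolding positive_definite_iff
    proof (intro allI impI)
      fix \<xi> :: "complex^'n"
      assume "\<xi> \<noteq> 0"
      then have r: "hermitian_form A \<xi> \<in> \<real>" "Re (hermitian_form A \<xi>) > 0"
        "hermitian_form (mat 1) \<xi> \<in> \<real>" "Re (hermitian_form (mat 1) \<xi>) > 0"
        using assms positive_definite_mat_1[where 'n = 'n] unfolding positive_definite_iff by blast+
      have "(1 - t) * Re (hermitian_form (mat 1) \<xi>) + t * Re (hermitian_form A \<xi>) > 0"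
        using r that by (cases "t = 0") (auto intro!: add_nonneg_pos)
      then show "hermitian_form (B t) \<xi> \<in> \<real> \<and> Re (hermitian_form (B t) \<xi>) > 0"
        using r unfolding eq by (auto simp: complex_is_Real_iff)
    qed
  qed
  have real: "det (B t) \<in> \<real>" if "0 \<le> t" "t \<le> 1" for t
    using hermitian_det_real positive_definite_hermitian[OF pd[OF that]] by blast
  have B0: "B 0 = mat 1" and B1: "B 1 = A"
    by (simp_all add: B_def vec_eq_iff)
  have cont: "continuous_on {0..1} (\<lambda>t. Re (det (B t)))"
    unfolding det_def B_def by (simp, intro continuous_intros)
  show "det A \<in> \<real>" using real[of 1] B1 by simp
  show "Re (det A) > 0"
  proof (rule ccontr)
    assume "\<not> Re (det A) > 0"
    then obtain t where t: "0 \<le> t" "t \<le> 1" "Re (det (B t)) = 0"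
      using IVT2'[OF _ _ _ cont, of 0] B0 B1 by auto
    then show False
      using positive_definite_det_nonzero[OF pd[of t]] real[of t]
      by (auto simp: complex_is_Real_iff complex_eq_iff)
  qed
qed

text \<open>Since \<open>a\<close> is \<open>A *v w\<close>, the sum is the conjugate of a value of
  the Hermitian form. For the Hessian and gradient of \<rho> this makes the squared norm of
  \<partial>\<rho> real and nonnegative.\<close>

lemma positive_definite_solution_form:
  assumes "positive_definite A" "A *v w = a"
  shows "(\<Sum>j\<in>UNIV. cnj (a $ j) * w $ j) \<in> \<real>" "Re (\<Sum>j\<in>UNIV. cnj (a $ j) * w $ j) \<ge> 0"
proof -
  define \<xi> where "\<xi> = (\<chi> i. cnj (w $ i))"
  have eq: "(\<Sum>j\<in>UNIV. cnj (a $ j) * w $ j) = cnj (hermitian_form A \<xi>)"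
    by (simp add: hermitian_form_def \<xi>_def assms(2)[symmetric] matrix_vector_mult_def
        sum_distrib_left sum_distrib_right mult_ac)
  have "hermitian_form A \<xi> \<in> \<real> \<and> Re (hermitian_form A \<xi>) \<ge> 0"
    using assms(1) by (cases "\<xi> = 0") (auto simp: positive_definite_iff hermitian_form_def less_eq_real_def)
  then show "(\<Sum>j\<in>UNIV. cnj (a $ j) * w $ j) \<in> \<real>" "Re (\<Sum>j\<in>UNIV. cnj (a $ j) * w $ j) \<ge> 0"
    unfolding eq by (auto simp: complex_is_Real_iff)
qed

section \<open>The top wedge power of a two-form as a multiple of a determinant\<close>

definition permute_half :: "bool \<Rightarrow> ('n \<Rightarrow> 'n) \<Rightarrow> 'n \<times> bool \<Rightarrow> 'n \<times> bool" where
  "permute_half c p x = (if snd x = c then (p (fst x), c) else x)"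

lemma permute_half_permutes:
  assumes "p permutes UNIV"
  shows "permute_half c p permutes UNIV"
proof -
  have "bij (permute_half c p)"
  proof (rule o_bij)
    have "inv p (p y) = y" "p (inv p y) = y" for y
      using permutes_inverses[OF assms] by auto
    then show "permute_half c (inv p) \<circ> permute_half c p = id"
      "permute_half c p \<circ> permute_half c (inv p) = id"
      by (auto simp: permute_half_def fun_eq_iff)
  qed
  then show ?thesis by (intro bij_imp_permutes) auto
qed

lemma sign_permute_half:
  fixes p :: "'n::finite \<Rightarrow> 'n"
  assumes "p permutes UNIV"
  shows "sign (permute_half c p) = sign p"
  using assms finite[of "UNIV :: 'n set"]
proof (induction p rule: permutes_induct)
  case id
  have "permute_half c (id :: 'n \<Rightarrow> 'n) = id" by (auto simp: permute_half_def fun_eq_iff)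
  then have "sign (permute_half c (id :: 'n \<Rightarrow> 'n)) = sign (id :: 'n \<times> bool \<Rightarrow> _)" by (rule arg_cong)
  then show ?case by (simp only: sign_id)
next
  case (swap a b p)
  have eq: "permute_half c (Transposition.transpose a b \<circ> p) = Transposition.transpose (a, c) (b, c) \<circ> permute_half c p"
    by (auto simp: permute_half_def fun_eq_iff Transposition.transpose_def)
  have "permutation (permute_half c p)" "permutation p"
    using permute_half_permutes[of p c] swap.hyps by (auto simp: permutation_permutes intro: exI[of _ UNIV])
  then show ?case
    unfolding eq using swap
    by (simp add: sign_compose permutation_swap_id sign_swap_id del: comp_apply o_apply)
qed

text \<open>Swapping the two positions of one pair flips the sign of the permutation, so the
  subtracted term contributes as much as the positive one. Doing this for one pair after another
  collects a factor 2 for each.\<close>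

lemma sum_permutations_skew_pairs:
  fixes b :: "'n::finite \<times> bool \<Rightarrow> 'n \<times> bool \<Rightarrow> complex"
  shows "(\<Sum>\<sigma> | \<sigma> permutes UNIV. of_int (sign \<sigma>) *
           (\<Prod>k\<in>UNIV. b (\<sigma> (k, False)) (\<sigma> (k, True)) - b (\<sigma> (k, True)) (\<sigma> (k, False)))) =
         2 ^ CARD('n) * (\<Sum>\<sigma> | \<sigma> permutes UNIV. of_int (sign \<sigma>) *
           (\<Prod>k\<in>UNIV. b (\<sigma> (k, False)) (\<sigma> (k, True))))"
proof -
  define X where "X k \<sigma> = b (\<sigma> (k, False)) (\<sigma> (k, True))" for k :: 'n and \<sigma>
  define Y where "Y k \<sigma> = b (\<sigma> (k, True)) (\<sigma> (k, False))" for k :: 'n and \<sigma>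
  have "(\<Sum>\<sigma> | \<sigma> permutes UNIV. of_int (sign \<sigma>) *
           (\<Prod>k\<in>UNIV. if k \<in> S then X k \<sigma> - Y k \<sigma> else X k \<sigma>)) =
         2 ^ card S * (\<Sum>\<sigma> | \<sigma> permutes UNIV. of_int (sign \<sigma>) * (\<Prod>k\<in>UNIV. X k \<sigma>))" for S
    using finite[of S]
  proof (induction S rule: finite_induct)
    case (insert k S)
    define Q where "Q \<sigma> = (\<Prod>l\<in>UNIV - {k}. if l \<in> S then X l \<sigma> - Y l \<sigma> else X l \<sigma>)" for \<sigma>
    define \<tau> where "\<tau> = Transposition.transpose (k, False) (k, True)"
    have \<tau>: "\<tau> permutes UNIV" unfolding \<tau>_def by (rule permutes_swap_id) auto
    have Q: "Q (\<sigma> \<circ> \<tau>) = Q \<sigma>" for \<sigma>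
      unfolding Q_def by (intro prod.cong refl) (auto simp: X_def Y_def \<tau>_def Transposition.transpose_def)
    have XY: "X k (\<sigma> \<circ> \<tau>) = Y k \<sigma>" for \<sigma> by (simp add: X_def Y_def \<tau>_def)
    have sg: "sign (\<sigma> \<circ> \<tau>) = - sign \<sigma>" if "\<sigma> permutes UNIV" for \<sigma> :: "'n \<times> bool \<Rightarrow> 'n \<times> bool"
    proof -
      have "permutation \<sigma>" using that by (auto simp: permutation_permutes)
      then show ?thesis by (simp add: \<tau>_def sign_compose permutation_swap_id sign_swap_id)
    qed
    have swap: "(\<Sum>\<sigma> | \<sigma> permutes UNIV. of_int (sign \<sigma>) * (X k \<sigma> * Q \<sigma>)) =
        (\<Sum>\<sigma> | \<sigma> permutes UNIV. - (of_int (sign \<sigma>) * (Y k \<sigma> * Q \<sigma>)))"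
      by (subst sum_permutations_compose_right[OF \<tau>]) (auto intro!: sum.cong simp: sg XY Q)
    have "(\<Sum>\<sigma> | \<sigma> permutes UNIV. of_int (sign \<sigma>) *
           (\<Prod>l\<in>UNIV. if l \<in> insert k S then X l \<sigma> - Y l \<sigma> else X l \<sigma>)) =
          (\<Sum>\<sigma> | \<sigma> permutes UNIV. of_int (sign \<sigma>) * ((X k \<sigma> - Y k \<sigma>) * Q \<sigma>))"
    proof (intro sum.cong refl arg_cong2[where f = "(*)"])
      fix \<sigma>
      have "Q \<sigma> = (\<Prod>l\<in>UNIV - {k}. if l \<in> insert k S then X l \<sigma> - Y l \<sigma> else X l \<sigma>)"
        unfolding Q_def by (intro prod.cong refl) auto
      then show "(\<Prod>l\<in>UNIV. if l \<in> insert k S then X l \<sigma> - Y l \<sigma> else X l \<sigma>) = (X k \<sigma> - Y k \<sigma>) * Q \<sigma>"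
        by (simp add: prod.remove[of UNIV k])
    qed
    also have "\<dots> = (\<Sum>\<sigma> | \<sigma> permutes UNIV. of_int (sign \<sigma>) * (X k \<sigma> * Q \<sigma>)) +
        (\<Sum>\<sigma> | \<sigma> permutes UNIV. - (of_int (sign \<sigma>) * (Y k \<sigma> * Q \<sigma>)))"
      unfolding sum.distrib[symmetric] by (intro sum.cong refl) (simp add: algebra_simps)
    also have "\<dots> = 2 * (\<Sum>\<sigma> | \<sigma> permutes UNIV. of_int (sign \<sigma>) * (X k \<sigma> * Q \<sigma>))"
      by (simp add: swap)
    also have "(\<Sum>\<sigma> | \<sigma> permutes UNIV. of_int (sign \<sigma>) * (X k \<sigma> * Q \<sigma>)) =
        (\<Sum>\<sigma> | \<sigma> permutes UNIV. of_int (sign \<sigma>) *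
           (\<Prod>l\<in>UNIV. if l \<in> S then X l \<sigma> - Y l \<sigma> else X l \<sigma>))"
      using insert.hyps by (intro sum.cong refl) (simp add: prod.remove[of UNIV k] Q_def)
    finally show ?case using insert by simp
  qed simp
  from this[of UNIV] show ?thesis by (simp only: X_def Y_def UNIV_I if_True)
qed

text \<open>Expanding the product, each choice of indices contributes a \<open>2n \<times> 2n\<close> determinant, which is a
  signed copy of one fixed determinant if the choice consists of two permutations, and \<open>0\<close> otherwise.\<close>

lemma wedge_power_eq_det:
  fixes V W :: "'n::finite \<Rightarrow> 'v \<Rightarrow> complex" and v :: "'n \<times> bool \<Rightarrow> 'v"
  obtains \<kappa> where "\<And>A :: complex^'n^'n. wedge_power (\<lambda>x y. \<Sum>i\<in>UNIV. \<Sum>j\<in>UNIV.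
      A $ i $ j * (V i x * W j y - V i y * W j x)) v = \<kappa> * det A"
proof -
  \<comment> \<open>Rows are the 2n functionals, \<open>V\<close> labelled \<open>False\<close> and
    \<open>W\<close> labelled \<open>True\<close>; columns are the 2n vectors on which the form is
    evaluated.\<close>
  define M :: "complex^('n \<times> bool)^('n \<times> bool)"
    where "M = (\<chi> x y. if snd x then W (fst x) (v y) else V (fst x) (v y))"
  define h where "h I J x = (if snd x then (J (fst x), True) else (I (fst x), False))"
    for I J :: "'n \<Rightarrow> 'n" and x
  define E where "E I J = (\<Sum>\<sigma> | \<sigma> permutes UNIV. of_int (sign \<sigma>) *
      (\<Prod>k\<in>UNIV. V (I k) (v (\<sigma> (k, False))) * W (J k) (v (\<sigma> (k, True)))))"
    for I J :: "'n \<Rightarrow> 'n"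
  have Edet: "E I J = det (\<chi> x. M $ h I J x)" for I J
  proof -
    have "(\<Prod>x\<in>UNIV. M $ h I J x $ \<sigma> x) =
        (\<Prod>k\<in>UNIV. V (I k) (v (\<sigma> (k, False))) * W (J k) (v (\<sigma> (k, True))))" for \<sigma>
    proof -
      have "(\<Prod>x\<in>UNIV. M $ h I J x $ \<sigma> x) = (\<Prod>k\<in>UNIV. \<Prod>c\<in>UNIV. M $ h I J (k, c) $ \<sigma> (k, c))"
        by (simp add: prod.cartesian_product)
      then show ?thesis by (simp add: UNIV_bool M_def h_def mult.commute)
    qed
    then show ?thesis unfolding det_def E_def by simp
  qed
  have perm: "E I J = of_int (sign I) * of_int (sign J) * det M"
    if "I permutes UNIV" "J permutes UNIV" for I J
  proof -
    \<comment> \<open>Two permutations of the n indices act as one permutation of the 2n row labels,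
      each on its own half, so the signs multiply.\<close>
    have h: "h I J = permute_half False I \<circ> permute_half True J"
      by (auto simp: h_def permute_half_def fun_eq_iff)
    have "permutation (permute_half c p)" if "p permutes UNIV" for c and p :: "'n \<Rightarrow> 'n"
      using permute_half_permutes[OF that] by (auto simp: permutation_permutes)
    then have "sign (h I J) = sign I * sign J"
      unfolding h using that by (simp add: sign_compose sign_permute_half)
    moreover have "h I J permutes UNIV"
      unfolding h using that by (intro permutes_compose permute_half_permutes)
    ultimately show ?thesis
      unfolding Edet using det_permute_rows[of "h I J" M] by simp
  qed
  have zero: "E I J = 0" if "\<not> (I permutes UNIV \<and> J permutes UNIV)" for I J
  proof -
    have "\<not> inj I \<or> \<not> inj J"
      using that finite_UNIV_inj_surj[of I] finite_UNIV_inj_surj[of J]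
      by (metis UNIV_I bijI bij_imp_permutes finite)
    then obtain x y where "x \<noteq> y" "h I J x = h I J y"
    proof
      assume "\<not> inj I"
      then obtain a b where "a \<noteq> b" "I a = I b" by (auto simp: inj_on_def)
      then show thesis by (intro that[of "(a, False)" "(b, False)"]) (auto simp: h_def)
    next
      assume "\<not> inj J"
      then obtain a b where "a \<noteq> b" "J a = J b" by (auto simp: inj_on_def)
      then show thesis by (intro that[of "(a, True)" "(b, True)"]) (auto simp: h_def)
    qed
    then show ?thesis
      unfolding Edet by (intro det_identical_rows[of x y]) (simp_all add: row_def)
  qed
  have W: "wedge_power (\<lambda>x y. \<Sum>i\<in>UNIV. \<Sum>j\<in>UNIV. A $ i $ j * (V i x * W j y - V i y * W j x)) v =
      (fact (CARD('n)) * det M) * det A" for A :: "complex^'n^'n"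
  proof -
    have expand: "(\<Prod>k\<in>UNIV. \<Sum>i\<in>UNIV. \<Sum>j\<in>UNIV. t k i j) =
        (\<Sum>I\<in>UNIV. \<Sum>J\<in>UNIV. \<Prod>k\<in>UNIV. t k (I k) (J k))"
      for t :: "'n \<Rightarrow> 'n \<Rightarrow> 'n \<Rightarrow> complex"
      by (simp add: prod_sum_PiE)
    define b where "b p q = (\<Sum>i\<in>UNIV. \<Sum>j\<in>UNIV. A $ i $ j * (V i (v p) * W j (v q)))" for p q
    have "wedge_power (\<lambda>x y. \<Sum>i\<in>UNIV. \<Sum>j\<in>UNIV. A $ i $ j * (V i x * W j y - V i y * W j x)) v =
      (\<Sum>\<sigma> | \<sigma> permutes UNIV. of_int (sign \<sigma>) *
           (\<Prod>k\<in>UNIV. b (\<sigma> (k, False)) (\<sigma> (k, True)) - b (\<sigma> (k, True)) (\<sigma> (k, False)))) / 2 ^ CARD('n)"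
      unfolding wedge_power_def b_def by (simp add: right_diff_distrib sum_subtractf)
    also have "\<dots> = (\<Sum>\<sigma> | \<sigma> permutes UNIV. of_int (sign \<sigma>) *
           (\<Prod>k\<in>UNIV. b (\<sigma> (k, False)) (\<sigma> (k, True))))"
      unfolding sum_permutations_skew_pairs by simp
    also have "\<dots> = (\<Sum>\<sigma> | \<sigma> permutes UNIV. \<Sum>I\<in>UNIV. \<Sum>J\<in>UNIV. (\<Prod>k\<in>UNIV. A $ I k $ J k) * (of_int (sign \<sigma>) *
        (\<Prod>k\<in>UNIV. V (I k) (v (\<sigma> (k, False))) * W (J k) (v (\<sigma> (k, True))))))"
      unfolding b_def expand by (simp add: prod.distrib sum_distrib_left mult_ac)
    also have "\<dots> = (\<Sum>I\<in>UNIV. \<Sum>J\<in>UNIV. (\<Prod>k\<in>UNIV. A $ I k $ J k) * E I J)"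
      unfolding E_def sum_distrib_left
      by (subst sum.swap) (intro sum.cong refl, rule sum.swap)
    also have "\<dots> = (\<Sum>I\<in>UNIV. \<Sum>J | J permutes UNIV. (\<Prod>k\<in>UNIV. A $ I k $ J k) * E I J)"
      by (intro sum.cong refl sum.mono_neutral_right) (simp_all add: zero)
    also have "\<dots> = (\<Sum>I | I permutes UNIV. \<Sum>J | J permutes UNIV. (\<Prod>k\<in>UNIV. A $ I k $ J k) * E I J)"
      by (intro sum.mono_neutral_right) (simp_all add: zero)
    also have "\<dots> = (\<Sum>I | I permutes (UNIV :: 'n set). det M * det A)"
    proof (intro sum.cong refl)
      fix I :: "'n \<Rightarrow> 'n" assume "I \<in> {I. I permutes UNIV}"
      then have I: "I permutes UNIV" by simp
      have pI: "permutation I" using I by (auto simp: permutation_permutes)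
      \<comment> \<open>Substituting \<open>J \<circ> I\<close> for \<open>J\<close> cancels the
        sign of \<open>I\<close> and reorders the product into that of \<open>J\<close> alone. The
        inner sum becomes \<open>det A\<close> times \<open>det M\<close> for every
        \<open>I\<close>, which accounts for the factorial.\<close>
      have "(\<Sum>J | J permutes UNIV. (\<Prod>k\<in>UNIV. A $ I k $ J k) * E I J) =
        (\<Sum>J | J permutes UNIV. (\<Prod>k\<in>UNIV. A $ I k $ (J \<circ> I) k) * E I (J \<circ> I))"
        by (rule sum_permutations_compose_right[OF I])
      also have "\<dots> = (\<Sum>J | J permutes UNIV. (of_int (sign J) * (\<Prod>k\<in>UNIV. A $ k $ J k)) * det M)"
      proof (intro sum.cong refl)
        fix J :: "'n \<Rightarrow> 'n" assume "J \<in> {J. J permutes UNIV}"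
        then have J: "J permutes UNIV" by simp
        have pJ: "permutation J" using J by (auto simp: permutation_permutes)
        have "(\<Prod>k\<in>UNIV. A $ I k $ (J \<circ> I) k) = (\<Prod>k\<in>UNIV. A $ k $ J k)"
          using prod.permute[OF I, of "\<lambda>k. A $ k $ J k"] by (simp add: o_def)
        moreover have "E I (J \<circ> I) = of_int (sign J) * det M"
          using perm[OF I permutes_compose[OF I J]] sign_idempotent[of I]
          by (simp add: sign_compose[OF pJ pI] mult_ac flip: of_int_mult)
        ultimately show "(\<Prod>k\<in>UNIV. A $ I k $ (J \<circ> I) k) * E I (J \<circ> I) =
          (of_int (sign J) * (\<Prod>k\<in>UNIV. A $ k $ J k)) * det M" by simp
      qed
      also have "\<dots> = det M * det A" unfolding det_def[of A] sum_distrib_left by (simp add: mult.commute)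
      finally show "(\<Sum>J | J permutes UNIV. (\<Prod>k\<in>UNIV. A $ I k $ J k) * E I J) = det M * det A" .
    qed
    also have "\<dots> = fact (CARD('n)) * det M * det A"
      using card_permutations[of "UNIV :: 'n set" "CARD('n)"] by simp
    finally show ?thesis .
  qed
  show thesis by (rule that[OF W])
qed

lemma wedge_power_ddc:
  obtains \<kappa> where "\<And>(u :: complex^'n \<Rightarrow> real) z.
    wedge_power (ddc u z) real_frame = \<kappa> * det (complex_hessian u z)"
proof -
  obtain \<kappa> where \<kappa>: "\<And>A :: complex^'n^'n. wedge_power (\<lambda>x y. \<Sum>i\<in>UNIV. \<Sum>j\<in>UNIV.
      A $ i $ j * (x $ i * cnj (y $ j) - y $ i * cnj (x $ j))) real_frame = \<kappa> * det A"
    by (rule wedge_power_eq_det[where V = "\<lambda>i x. x $ i" and W = "\<lambda>j x. cnj (x $ j)" and v = real_frame]) blast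
  have "wedge_power (ddc u z) real_frame = \<i> ^ CARD('n) * \<kappa> * det (complex_hessian u z)"
    for u :: "complex^'n \<Rightarrow> real" and z
  proof -
    have scale: "wedge_power (\<lambda>x y. c * \<beta> x y) v = c ^ CARD('n) * wedge_power \<beta> v"
      for c and \<beta> :: "complex^'n \<Rightarrow> complex^'n \<Rightarrow> complex" and v :: "'n \<times> bool \<Rightarrow> complex^'n"
      unfolding wedge_power_def prod.distrib by (simp add: sum_distrib_left mult.left_commute)
    show ?thesis
      using scale[of \<i> _ real_frame] \<kappa>[of "complex_hessian u z"] by (simp add: ddc_def[abs_def] mult.assoc)
  qed
  then show thesis by (rule that)
qed

subsection \<open>Integration by parts against \<open>\<partial>\<rho>\<close>\<close>

lemma frechet_derivative_of_real:
  assumes "u differentiable (at z)"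
  shows "frechet_derivative (\<lambda>w. complex_of_real (u w)) (at z) v = of_real (frechet_derivative u (at z) v)"
  by (rule frechet_derivative_bounded_linear[OF bounded_linear_of_real assms])

lemma dzbar_of_real:
  assumes "u differentiable (at z)"
  shows "dzbar i (\<lambda>w. complex_of_real (u w)) z = cnj (dz i (\<lambda>w. complex_of_real (u w)) z)"
  by (simp add: dz_def dzbar_def frechet_derivative_of_real[OF assms])

lemma dz_of_real_compose:
  assumes "u differentiable (at z)" "(h has_real_derivative h') (at (u z))"
  shows "(\<lambda>w. h (u w)) differentiable (at z)"
    and "dz i (\<lambda>w. complex_of_real (h (u w))) z = of_real h' * dz i (\<lambda>w. complex_of_real (u w)) z"
    and "dzbar i (\<lambda>w. complex_of_real (h (u w))) z = of_real h' * dzbar i (\<lambda>w. complex_of_real (u w)) z"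
proof -
  have "(h has_derivative (*) h') (at (u z))"
    using assms(2) by (simp add: has_field_derivative_def)
  from has_derivative_compose[OF assms(1)[unfolded frechet_derivative_works] this]
  have d: "((\<lambda>w. h (u w)) has_derivative (\<lambda>v. h' * frechet_derivative u (at z) v)) (at z)" .
  then show diff: "(\<lambda>w. h (u w)) differentiable (at z)" by (auto simp: differentiable_def)
  show "dz i (\<lambda>w. complex_of_real (h (u w))) z = of_real h' * dz i (\<lambda>w. complex_of_real (u w)) z"
    "dzbar i (\<lambda>w. complex_of_real (h (u w))) z = of_real h' * dzbar i (\<lambda>w. complex_of_real (u w)) z"
    by (simp_all add: dz_def dzbar_def frechet_derivative_of_real[OF diff]
        frechet_derivative_of_real[OF assms(1)] frechet_derivative_eqI[OF d] field_simps)
qed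

lemma continuous_on_det:
  fixes A :: "'a::topological_space \<Rightarrow> complex^'n^'n"
  assumes "\<And>i j. continuous_on S (\<lambda>z. A z $ i $ j)"
  shows "continuous_on S (\<lambda>z. det (A z))"
  unfolding det_def by (intro continuous_intros assms)

lemma matrix_inv_inverse:
  fixes A :: "complex^'n^'n"
  assumes "det A \<noteq> 0"
  shows "A ** matrix_inv A = mat 1" "matrix_inv A ** A = mat 1"
proof -
  have "\<exists>B. A ** B = mat 1 \<and> B ** A = mat 1"
    using assms by (simp add: invertible_det_nz[symmetric] invertible_def)
  then have "A ** matrix_inv A = mat 1 \<and> matrix_inv A ** A = mat 1"
    unfolding matrix_inv_def by (rule someI_ex)
  then show "A ** matrix_inv A = mat 1" "matrix_inv A ** A = mat 1" by auto
qed

locale negative_strictly_psh =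
  fixes \<Omega> :: "(complex ^ 'n) set" and \<rho> :: "complex ^ 'n \<Rightarrow> real"
  assumes open_\<Omega>: "open \<Omega>" and neg: "z \<in> \<Omega> \<Longrightarrow> \<rho> z < 0"
    and psh: "smooth_strictly_psh_on \<Omega> \<rho>"
begin

abbreviation \<rho>\<^sub>c :: "complex ^ 'n \<Rightarrow> complex" where "\<rho>\<^sub>c \<equiv> \<lambda>w. complex_of_real (\<rho> w)"

abbreviation H :: "complex ^ 'n \<Rightarrow> complex ^ 'n ^ 'n" where "H \<equiv> complex_hessian \<rho>"

definition del :: "complex ^ 'n \<Rightarrow> complex ^ 'n" where "del z = (\<chi> i. dz i \<rho>\<^sub>c z)"

text \<open>This is the vector \<open>w\<close> with \<open>H z *v w = del z\<close> that the
  determinant lemmas ask for.\<close>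

definition grad :: "complex ^ 'n \<Rightarrow> complex ^ 'n" where "grad z = matrix_inv (H z) *v del z"

definition hdet :: "complex ^ 'n \<Rightarrow> real" where "hdet z = Re (det (H z))"

text \<open>The function \<open>grad_sq\<close> is \<open>|\<partial>\<rho>|\<^sup>2\<close> with respect to the metric \<open>dd\<^sup>c \<rho>\<close>.\<close>

definition grad_sq :: "complex ^ 'n \<Rightarrow> real" where "grad_sq z = Re (\<Sum>j\<in>UNIV. cnj (del z $ j) * grad z $ j)"

lemma Ck_\<rho>: "Ck_on k \<Omega> \<rho>"
  using psh by (simp add: smooth_strictly_psh_on_def smooth_on_def)

lemma Ck_\<rho>\<^sub>c: "Ck_on k \<Omega> \<rho>\<^sub>c"
  by (rule Ck_on_bounded_linear[OF open_\<Omega> bounded_linear_of_real Ck_\<rho>])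

lemma Ck_dz_\<rho>\<^sub>c: "Ck_on k \<Omega> (dz i \<rho>\<^sub>c)" "Ck_on k \<Omega> (dzbar i \<rho>\<^sub>c)"
  by (rule Ck_on_dz[OF open_\<Omega> Ck_\<rho>\<^sub>c])+

lemma diff_\<rho>: "z \<in> \<Omega> \<Longrightarrow> \<rho> differentiable (at z)"
  using Ck_\<rho>[of "Suc 0"] by simp

lemma diff_dzbar: "z \<in> \<Omega> \<Longrightarrow> dzbar j \<rho>\<^sub>c differentiable (at z)"
  using Ck_dz_\<rho>\<^sub>c(2)[of "Suc 0"] by simp

lemma continuous_on_\<rho>: "continuous_on \<Omega> \<rho>"
  by (rule Ck_on_imp_continuous_on[OF Ck_\<rho>])

lemma continuous_on_del: "continuous_on \<Omega> (\<lambda>z. del z $ i)"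
  using Ck_on_imp_continuous_on[OF Ck_dz_\<rho>\<^sub>c(1)] by (simp add: del_def)

lemma H_nth: "H z $ i $ j = dz i (dzbar j \<rho>\<^sub>c) z"
  by (simp add: complex_hessian_def)

lemma continuous_on_H: "continuous_on \<Omega> (\<lambda>z. H z $ i $ j)"
  unfolding H_nth by (rule Ck_on_imp_continuous_on[OF Ck_on_dz(1)[OF open_\<Omega> Ck_dz_\<rho>\<^sub>c(2)]])

lemma dzbar_\<rho>\<^sub>c: "z \<in> \<Omega> \<Longrightarrow> dzbar j \<rho>\<^sub>c z = cnj (del z $ j)"
  by (simp add: dzbar_of_real[OF diff_\<rho>] del_def)

lemma H_positive_definite: "z \<in> \<Omega> \<Longrightarrow> positive_definite (H z)"
  using psh by (simp add: smooth_strictly_psh_on_def)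

lemma hdet_pos: "z \<in> \<Omega> \<Longrightarrow> hdet z > 0"
  unfolding hdet_def by (rule positive_definite_det_pos(2)[OF H_positive_definite])

lemma det_H: "z \<in> \<Omega> \<Longrightarrow> det (H z) = of_real (hdet z)"
  using positive_definite_det_pos(1)[OF H_positive_definite] by (simp add: hdet_def complex_is_Real_iff complex_eq_iff)

lemma H_grad: "z \<in> \<Omega> \<Longrightarrow> H z *v grad z = del z"
  using positive_definite_det_nonzero[OF H_positive_definite]
  by (simp add: grad_def matrix_vector_mul_assoc matrix_inv_inverse)

lemma of_real_grad_sq: "z \<in> \<Omega> \<Longrightarrow> (\<Sum>j\<in>UNIV. cnj (del z $ j) * grad z $ j) = of_real (grad_sq z)"
  using positive_definite_solution_form(1)[OF H_positive_definite H_grad]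
  by (simp add: grad_sq_def complex_is_Real_iff complex_eq_iff)

lemma grad_sq_nonneg: "z \<in> \<Omega> \<Longrightarrow> grad_sq z \<ge> 0"
  unfolding grad_sq_def by (rule positive_definite_solution_form(2)[OF H_positive_definite H_grad])

lemma continuous_on_hdet: "continuous_on \<Omega> hdet"
  unfolding hdet_def by (intro continuous_intros continuous_on_det continuous_on_H)

text \<open>Cramer's rule turns the inverse matrix hidden in \<open>grad\<close> into quotients of
  determinants with continuous entries.\<close>

lemma continuous_on_grad_sq: "continuous_on \<Omega> grad_sq"
proof -
  have "grad_sq z = Re (\<Sum>j\<in>UNIV. cnj (del z $ j) * det (replace_column (H z) j (del z))) / hdet z" if "z \<in> \<Omega>" for z
  proof -
    have "(\<Sum>j\<in>UNIV. cnj (del z $ j) * det (replace_column (H z) j (del z))) =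
        (\<Sum>j\<in>UNIV. cnj (del z $ j) * grad z $ j) * of_real (hdet z)"
      by (simp add: det_replace_column_solution[OF H_grad[OF that]] det_H[OF that] sum_distrib_right mult.assoc)
    then show ?thesis using hdet_pos[OF that] by (simp add: of_real_grad_sq[OF that])
  qed
  moreover have "continuous_on \<Omega> (\<lambda>z. det (replace_column (H z) j (del z)))" for j
  proof (rule continuous_on_det)
    fix i l
    show "continuous_on \<Omega> (\<lambda>z. replace_column (H z) j (del z) $ i $ l)"
      by (cases "l = j") (simp_all add: replace_column_def continuous_on_del continuous_on_H)
  qed
  moreover have "\<forall>z\<in>\<Omega>. hdet z \<noteq> 0" using hdet_pos by force
  ultimately show ?thesis
    by (subst continuous_on_cong[OF refl]) (auto intro!: continuous_intros continuous_on_del continuous_on_hdet)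
qed

lemma continuous_on_compose_neg:
  "continuous_on {0<..} h \<Longrightarrow> continuous_on \<Omega> (\<lambda>z. h (- \<rho> z) :: real)"
  by (rule continuous_on_compose2[of "{0<..}" h]) (auto intro!: continuous_intros continuous_on_\<rho> neg)

text \<open>Used twice: with \<open>h (- t)\<close> for the integration by parts, and with
  \<open>1 / - t\<close> for the Hessian of the metric potential
  \<open>- ln (- \<rho> z)\<close>.\<close>

lemma dz_compose_mult_dzbar:
  assumes z: "z \<in> \<Omega>" and k: "(k has_real_derivative k') (at (\<rho> z))"
  shows "dz i (\<lambda>w. of_real (k (\<rho> w)) * dzbar j \<rho>\<^sub>c w) z =
    of_real k' * del z $ i * cnj (del z $ j) + of_real (k (\<rho> z)) * H z $ i $ j"
proof -
  have "(\<lambda>w. complex_of_real (k (\<rho> w))) differentiable (at z)"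
    using bounded_linear.has_derivative[OF bounded_linear_of_real]
      dz_of_real_compose(1)[OF diff_\<rho>[OF z] k] unfolding differentiable_def by blast
  then show ?thesis
    using dz_of_real_compose(2)[OF diff_\<rho>[OF z] k, of i]
    by (simp add: dz_mult[OF _ diff_dzbar[OF z]] dzbar_\<rho>\<^sub>c[OF z] H_nth del_def)
qed

text \<open>The new column is the image under \<open>H z\<close> of
  \<open>c *s axis j 1 + e *s grad z\<close>, and Cramer's rule reads off the \<open>j\<close>-th
  coordinate of that vector.\<close>

lemma det_replace_column_combination:
  assumes "z \<in> \<Omega>"
  shows "det (\<chi> i l. if l = j then c * H z $ i $ j + e * del z $ i else H z $ i $ l) =
    (c + e * grad z $ j) * of_real (hdet z)"
proof -
  have mult_axis: "H z *v axis j 1 = column j (H z)"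
    unfolding matrix_vector_mult_def column_def by (simp add: sum_mult_axis)
  have "H z *v (c *s axis j 1 + e *s grad z) = c *s column j (H z) + e *s del z"
    unfolding matrix_vector_right_distrib vector_scalar_commute mult_axis H_grad[OF assms] ..
  from det_replace_column_solution[OF this, of j]
  have "det (replace_column (H z) j (c *s column j (H z) + e *s del z)) = (c + e * grad z $ j) * of_real (hdet z)"
    by (simp add: det_H[OF assms])
  moreover have "replace_column (H z) j (c *s column j (H z) + e *s del z) =
      (\<chi> i l. if l = j then c * H z $ i $ j + e * del z $ i else H z $ i $ l)"
    by (auto simp: replace_column_def column_def vec_eq_iff)
  ultimately show ?thesis by simp
qed

text \<open>The boundary terms vanish because \<open>h(-\<rho>)\<close> is supported in a sublevel set of the exhaustion.\<close>

lemma integration_by_parts: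
  fixes h h' :: "real \<Rightarrow> real"
  assumes ex: "exhaustion_on \<Omega> \<rho>" and c: "c > 0"
    and h: "\<And>t. t > 0 \<Longrightarrow> (h has_real_derivative h' t) (at t)" "continuous_on {0<..} h'"
    and h0: "\<And>t. 0 < t \<Longrightarrow> t \<le> c \<Longrightarrow> h t = 0 \<and> h' t = 0"
    and nonneg: "\<And>t. t > 0 \<Longrightarrow> h t \<ge> 0 \<and> h' t \<ge> 0"
  shows "(\<integral>\<^sup>+z. ennreal (indicator \<Omega> z * (real CARD('n) * h (- \<rho> z) * hdet z)) \<partial>lborel) =
    (\<integral>\<^sup>+z. ennreal (indicator \<Omega> z * (h' (- \<rho> z) * grad_sq z * hdet z)) \<partial>lborel)"
proof -
  define K where "K = closure {z\<in>\<Omega>. \<rho> z < - c / 2}"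
  have K: "compact K" "K \<subseteq> \<Omega>"
    using ex c unfolding exhaustion_on_def K_def by (auto dest!: spec[of _ "- c / 2"])
  have off: "h (- \<rho> z) = 0" "h' (- \<rho> z) = 0" if "z \<in> \<Omega>" "z \<notin> K" for z
  proof -
    have "{z\<in>\<Omega>. \<rho> z < - c / 2} \<subseteq> K" unfolding K_def by (rule closure_subset)
    then have "- \<rho> z \<le> c" using that c by force
    then show "h (- \<rho> z) = 0" "h' (- \<rho> z) = 0" using h0[of "- \<rho> z"] neg[OF that(1)] by auto
  qed
  have conth: "continuous_on {0<..} h"
    using h(1) by (auto intro!: continuous_at_imp_continuous_on DERIV_isCont)
  define f1 where "f1 z = indicator \<Omega> z * (real CARD('n) * h (- \<rho> z) * hdet z)" for z
  define f2 where "f2 z = indicator \<Omega> z * (h' (- \<rho> z) * grad_sq z * hdet z)" for z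
  have int: "integrable lborel (\<lambda>z. indicator \<Omega> z * f z)"
    if "continuous_on \<Omega> f" "\<And>z. z \<in> \<Omega> \<Longrightarrow> z \<notin> K \<Longrightarrow> f z = 0" for f :: "complex ^ 'n \<Rightarrow> real"
  proof (rule integrable_compact_support[OF K(1)])
    have "continuous_on K f" using that(1) K(2) by (rule continuous_on_subset)
    then show "continuous_on K (\<lambda>z. indicator \<Omega> z * f z)"
      using K(2) by (subst continuous_on_cong[OF refl, where g = f]) auto
  qed (use that in \<open>auto simp: indicator_def\<close>)
  have int1: "integrable lborel f1"
    unfolding f1_def using off(1)
    by (intro int continuous_intros continuous_on_compose_neg conth continuous_on_hdet) simp
  have int2: "integrable lborel f2"
    unfolding f2_def using off(2)
    by (intro int continuous_intros continuous_on_compose_neg h(2) continuous_on_hdet continuous_on_grad_sq) simp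
  \<comment> \<open>Extension by 0 makes the function total with support in \<open>K\<close>, as the
    null Lagrangian lemma requires; inside \<Omega> it is the conjugate derivative of \<rho>
    weighted by \<open>h (- \<rho> z)\<close>.\<close>
  define \<phi> where "\<phi> j z = (if z \<in> \<Omega> then of_real (h (- \<rho> z)) * dzbar j \<rho>\<^sub>c z else 0)" for j z
  define M where "M j z = (\<chi> i l. if l = j then dz i (\<phi> j) z else dz i (dzbar l \<rho>\<^sub>c) z)" for j z
  have \<phi>1: "Ck_on 1 \<Omega> (\<phi> j)" for j
  proof -
    have "Ck_on 1 \<Omega> (\<lambda>z. - \<rho> z)"
      by (rule Ck_on_bounded_linear[OF open_\<Omega> bounded_linear_minus[OF bounded_linear_ident] Ck_\<rho>])
    then have "Ck_on 1 \<Omega> (\<lambda>z. h (- \<rho> z))"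
      using neg by (intro C1_on_compose_real[OF open_\<Omega> _ _ h]) auto
    then have "Ck_on 1 \<Omega> (\<lambda>z. of_real (h (- \<rho> z)) * dzbar j \<rho>\<^sub>c z)"
      by (intro Ck_on_mult open_\<Omega> Ck_dz_\<rho>\<^sub>c Ck_on_bounded_linear[OF open_\<Omega> bounded_linear_of_real])
    then show ?thesis
      by (rule iffD2[OF Ck_on_cong[OF open_\<Omega>], rotated]) (simp add: \<phi>_def)
  qed
  have \<phi>0: "\<phi> j z = 0" if "z \<notin> K" for j z using off(1) that by (auto simp: \<phi>_def)
  have M: "integrable lborel (\<lambda>z. det (M j z))" "(LINT z|lborel. det (M j z)) = 0"
    "\<And>z. z \<notin> K \<Longrightarrow> det (M j z) = 0" for j
    unfolding M_def by (rule integral_det_dz_compact_support[OF open_\<Omega> K \<phi>1 \<phi>0 Ck_dz_\<rho>\<^sub>c(2)]; assumption)+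
  have detM: "det (M j z) =
      (of_real (h (- \<rho> z)) + of_real (- h' (- \<rho> z)) * cnj (del z $ j) * grad z $ j) * of_real (hdet z)"
    if z: "z \<in> \<Omega>" for j z
  proof -
    have "((\<lambda>t. h (- t)) has_real_derivative - h' (- \<rho> z)) (at (\<rho> z))"
      using DERIV_chain2[where f = h and g = uminus and x = "\<rho> z" and Da = "h' (- \<rho> z)" and Db = "- 1"]
        h(1)[of "- \<rho> z"] neg[OF z] by (simp add: DERIV_minus)
    note k = dz_compose_mult_dzbar[OF z this]
    have "dz i (\<phi> j) z = dz i (\<lambda>w. of_real (h (- \<rho> w)) * dzbar j \<rho>\<^sub>c w) z" for i
      by (rule dz_cong_open(1)[OF open_\<Omega> z]) (simp add: \<phi>_def)
    then have col: "dz i (\<phi> j) z = of_real (h (- \<rho> z)) * H z $ i $ j +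
        of_real (- h' (- \<rho> z)) * cnj (del z $ j) * del z $ i" for i
      unfolding k by (simp add: mult_ac)
    have "M j z = (\<chi> i l. if l = j then of_real (h (- \<rho> z)) * H z $ i $ j +
        of_real (- h' (- \<rho> z)) * cnj (del z $ j) * del z $ i else H z $ i $ l)"
      by (simp only: M_def col H_nth)
    then show ?thesis by (simp add: det_replace_column_combination[OF z] del: of_real_minus)
  qed
  have sum: "(\<Sum>j\<in>UNIV. det (M j z)) = of_real (f1 z - f2 z)" for z
  proof (cases "z \<in> \<Omega>")
    case True
    have "(\<Sum>j\<in>UNIV. det (M j z)) = (of_nat CARD('n) * of_real (h (- \<rho> z)) -
        of_real (h' (- \<rho> z)) * (\<Sum>j\<in>UNIV. cnj (del z $ j) * grad z $ j)) * of_real (hdet z)"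
      unfolding detM[OF True] by (simp add: algebra_simps sum.distrib sum_distrib_left sum_subtractf)
    then show ?thesis
      unfolding of_real_grad_sq[OF True] using True by (simp add: f1_def f2_def algebra_simps)
  next
    case False
    then have "z \<notin> K" using K by auto
    then show ?thesis using False M(3) by (simp add: f1_def f2_def)
  qed
  have "complex_of_real (LINT z|lborel. f1 z - f2 z) = (LINT z|lborel. (\<Sum>j\<in>UNIV. det (M j z)))"
    unfolding sum by (rule integral_complex_of_real[symmetric])
  also have "\<dots> = 0"
    using M(1,2) by (subst Bochner_Integration.integral_sum) auto
  finally have "(LINT z|lborel. f1 z) = (LINT z|lborel. f2 z)"
    using int1 int2 by simp
  \<comment> \<open>Nonnegativity moves the identity from Bochner integrals to integrals with values
    in \<open>ennreal\<close>, where the later limit may be infinite.\<close>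
  moreover have "f1 z \<ge> 0" "f2 z \<ge> 0" for z
    unfolding f1_def f2_def using nonneg[of "- \<rho> z"] neg[of z] hdet_pos[of z] grad_sq_nonneg[of z]
    by (cases "z \<in> \<Omega>"; simp add: less_imp_le)+
  ultimately show ?thesis
    using int1 int2 by (simp add: nn_integral_eq_integral flip: f1_def f2_def)
qed

end

subsection \<open>Powers of \<open>-\<rho>\<close>\<close>

text \<open>Squaring removes the corner of the positive part: at 0 the difference quotient at
  \<open>h\<close> is at most \<open>\<bar>h\<bar>\<close>. This is why the truncation below squares
  the positive part and then divides by \<open>s\<close> to restore linear growth.\<close>

lemma has_real_derivative_max_0_power2:
  "((\<lambda>x :: real. (max 0 x)\<^sup>2) has_real_derivative 2 * max 0 x) (at x)"
proof (cases x "0 :: real" rule: linorder_cases)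
  case less
  have "((\<lambda>x :: real. 0) has_real_derivative 2 * max 0 x) (at x)" using less by simp
  then show ?thesis
    by (rule has_field_derivative_transform_within_open[where S = "{..<0}"]) (use less in auto)
next
  case equal
  have "((\<lambda>h :: real. (max 0 h)\<^sup>2 / h) \<longlongrightarrow> 0) (at 0)"
  proof (rule Lim_null_comparison)
    show "((\<lambda>h :: real. \<bar>h\<bar>) \<longlongrightarrow> 0) (at 0)" by (intro tendsto_eq_intros) auto
    have "norm ((max 0 h)\<^sup>2 / h) \<le> \<bar>h\<bar>" for h :: real
      by (cases "h \<le> 0") (auto simp: max_def power2_eq_square)
    then show "\<forall>\<^sub>F h :: real in at 0. norm ((max 0 h)\<^sup>2 / h) \<le> \<bar>h\<bar>" by simp
  qed
  then show ?thesis by (simp add: equal DERIV_def)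
next
  case greater
  have "((\<lambda>x :: real. x\<^sup>2) has_real_derivative 2 * max 0 x) (at x)"
    using greater by (auto intro!: derivative_eq_intros)
  then show ?thesis
    by (rule has_field_derivative_transform_within_open[where S = "{0<..}"]) (use greater in auto)
qed

text \<open>Composed with \<open>t \<mapsto> t powr \<beta>\<close>, the convex functions \<open>s \<mapsto> (s - \<delta>)\<^sub>+\<^sup>2 / s\<close> increase to
  \<open>t powr \<beta>\<close> as \<open>\<delta>\<close> decreases to \<open>0\<close>, and so do their derivatives.\<close>

definition truncated_powr :: "real \<Rightarrow> real \<Rightarrow> real \<Rightarrow> real" where
  "truncated_powr \<beta> \<delta> t = (max 0 (t powr \<beta> - \<delta>))\<^sup>2 / t powr \<beta>"

definition truncated_powr' :: "real \<Rightarrow> real \<Rightarrow> real \<Rightarrow> real" where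
  "truncated_powr' \<beta> \<delta> t = max 0 (1 - \<delta>\<^sup>2 / (t powr \<beta>)\<^sup>2) * (\<beta> * t powr (\<beta> - 1))"

text \<open>For \<open>s > \<delta>\<close> the quotient equals s - 2 \<delta> + \<delta>^2 / s,
  with derivative 1 - \<delta>^2 / s^2. This changes sign exactly at \<delta>, so one
  \<open>max\<close> covers both cases.\<close>

lemma truncated_powr_has_derivative:
  assumes "t > 0" "\<delta> > 0"
  shows "(truncated_powr \<beta> \<delta> has_real_derivative truncated_powr' \<beta> \<delta> t) (at t)"
proof -
  define s where "s = t powr \<beta>"
  have s: "s > 0" using assms by (simp add: s_def)
  have "((\<lambda>s. (max 0 (s - \<delta>))\<^sup>2) has_real_derivative 2 * max 0 (s - \<delta>)) (at s)"
    using DERIV_chain2[where f = "\<lambda>x. (max 0 x)\<^sup>2" and g = "\<lambda>s. s - \<delta>" and x = s and Db = 1,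
        OF has_real_derivative_max_0_power2] by (simp add: DERIV_diff[where E = 0, simplified])
  from DERIV_divide[OF this DERIV_ident] s
  have "((\<lambda>s. (max 0 (s - \<delta>))\<^sup>2 / s) has_real_derivative
      (2 * max 0 (s - \<delta>) * s - (max 0 (s - \<delta>))\<^sup>2 * 1) / (s * s)) (at s)" by simp
  also have "(2 * max 0 (s - \<delta>) * s - (max 0 (s - \<delta>))\<^sup>2 * 1) / (s * s) = max 0 (1 - \<delta>\<^sup>2 / s\<^sup>2)"
  proof (cases "s \<le> \<delta>")
    case True
    then have "s\<^sup>2 \<le> \<delta>\<^sup>2" using s by (intro power_mono) auto
    then show ?thesis using True s by (simp add: max_def field_simps)
  next
    case False
    then have "\<delta>\<^sup>2 \<le> s\<^sup>2" using assms by (intro power_mono) auto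
    then show ?thesis using False s by (simp add: max_def field_simps power2_eq_square)
  qed
  finally have "((\<lambda>s. (max 0 (s - \<delta>))\<^sup>2 / s) has_real_derivative max 0 (1 - \<delta>\<^sup>2 / s\<^sup>2)) (at s)" .
  from DERIV_chain2[OF this[unfolded s_def] has_real_derivative_powr[OF assms(1), of \<beta>]]
  show ?thesis unfolding truncated_powr_def[abs_def] truncated_powr'_def .
qed

lemma continuous_on_truncated_powr:
  "continuous_on {0<..} (truncated_powr \<beta> \<delta>)" "continuous_on {0<..} (truncated_powr' \<beta> \<delta>)"
  unfolding truncated_powr_def[abs_def] truncated_powr'_def[abs_def]
  by (auto intro!: continuous_intros)

text \<open>The bound on \<open>t\<close> is the point where \<open>t powr \<beta>\<close> reaches
  \<delta>. As \<beta> is positive, smaller \<open>t\<close> stay below that value.\<close>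

lemma truncated_powr_eq_0:
  assumes "0 < t" "t \<le> \<delta> powr (1 / \<beta>)" "\<beta> > 0" "\<delta> > 0"
  shows "truncated_powr \<beta> \<delta> t = 0 \<and> truncated_powr' \<beta> \<delta> t = 0"
proof -
  have "t powr \<beta> \<le> (\<delta> powr (1 / \<beta>)) powr \<beta>"
    using assms by (intro powr_mono2) auto
  then have le: "t powr \<beta> \<le> \<delta>" using assms by (simp add: powr_powr)
  then have "(t powr \<beta>)\<^sup>2 \<le> \<delta>\<^sup>2" using assms by (intro power_mono) auto
  then have "1 - \<delta>\<^sup>2 / (t powr \<beta>)\<^sup>2 \<le> 0" using assms by (simp add: field_simps)
  then show ?thesis using le by (simp add: truncated_powr_def truncated_powr'_def)
qed

lemma truncated_powr_nonneg:
  "\<beta> > 0 \<Longrightarrow> truncated_powr \<beta> \<delta> t \<ge> 0 \<and> truncated_powr' \<beta> \<delta> t \<ge> 0"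
  by (simp add: truncated_powr_def truncated_powr'_def)

lemma truncated_powr_antimono:
  assumes "t > 0" "\<beta> > 0" "0 < \<delta>" "\<delta> \<le> \<epsilon>"
  shows "truncated_powr \<beta> \<epsilon> t \<le> truncated_powr \<beta> \<delta> t" "truncated_powr' \<beta> \<epsilon> t \<le> truncated_powr' \<beta> \<delta> t"
proof -
  have "\<delta>\<^sup>2 \<le> \<epsilon>\<^sup>2" using assms by (intro power_mono) auto
  then have "1 - \<epsilon>\<^sup>2 / (t powr \<beta>)\<^sup>2 \<le> 1 - \<delta>\<^sup>2 / (t powr \<beta>)\<^sup>2"
    by (intro diff_left_mono divide_right_mono) auto
  then show "truncated_powr' \<beta> \<epsilon> t \<le> truncated_powr' \<beta> \<delta> t"
    unfolding truncated_powr'_def using assms by (intro mult_right_mono max.mono) auto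
  show "truncated_powr \<beta> \<epsilon> t \<le> truncated_powr \<beta> \<delta> t"
    unfolding truncated_powr_def using assms by (intro divide_right_mono power_mono max.mono) auto
qed

lemma truncated_powr_tendsto:
  assumes "t > 0"
  shows "(\<lambda>m. truncated_powr \<beta> (1 / real (Suc m)) t) \<longlonglongrightarrow> t powr \<beta>"
    and "(\<lambda>m. truncated_powr' \<beta> (1 / real (Suc m)) t) \<longlonglongrightarrow> \<beta> * t powr (\<beta> - 1)"
proof -
  have s: "t powr \<beta> > 0" using assms by simp
  have \<delta>: "(\<lambda>m. 1 / real (Suc m)) \<longlonglongrightarrow> 0" by (rule LIMSEQ_Suc[OF lim_1_over_n])
  have "(\<lambda>m. truncated_powr \<beta> (1 / real (Suc m)) t) \<longlonglongrightarrow> (max 0 (t powr \<beta> - 0))\<^sup>2 / t powr \<beta>"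
    unfolding truncated_powr_def using s by (intro tendsto_intros \<delta>) auto
  also have "(max 0 (t powr \<beta> - 0))\<^sup>2 / t powr \<beta> = t powr \<beta>"
    using s by (simp add: power2_eq_square)
  finally show "(\<lambda>m. truncated_powr \<beta> (1 / real (Suc m)) t) \<longlonglongrightarrow> t powr \<beta>" .
  have "(\<lambda>m. truncated_powr' \<beta> (1 / real (Suc m)) t) \<longlonglongrightarrow>
      max 0 (1 - 0\<^sup>2 / (t powr \<beta>)\<^sup>2) * (\<beta> * t powr (\<beta> - 1))"
    unfolding truncated_powr'_def using s by (intro tendsto_intros \<delta>) auto
  then show "(\<lambda>m. truncated_powr' \<beta> (1 / real (Suc m)) t) \<longlonglongrightarrow> \<beta> * t powr (\<beta> - 1)" by simp
qed

section \<open>Removing the truncation by monotone convergence\<close>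

context negative_strictly_psh
begin

lemma measurable_indicator:
  "continuous_on \<Omega> f \<Longrightarrow> (\<lambda>z. indicator \<Omega> z * f z :: real) \<in> borel_measurable lborel"
  using borel_measurable_continuous_on_indicator[of \<Omega> f] open_\<Omega> by simp

text \<open>The weight \<open>p\<close> is kept general so that both sides of the integration by
  parts are covered: \<open>hdet\<close> on one, \<open>grad_sq\<close> times \<open>hdet\<close> on
  the other.\<close>

lemma nn_integral_monotone_limit:
  fixes k :: "nat \<Rightarrow> real \<Rightarrow> real"
  assumes cont: "\<And>m. continuous_on {0<..} (k m)" "continuous_on \<Omega> p"
    and mono: "\<And>m n t. t > 0 \<Longrightarrow> m \<le> n \<Longrightarrow> k m t \<le> k n t" and p: "\<And>z. z \<in> \<Omega> \<Longrightarrow> p z \<ge> 0"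
    and lim: "\<And>t. t > 0 \<Longrightarrow> (\<lambda>m. k m t) \<longlonglongrightarrow> k' t"
  shows "(\<lambda>m. \<integral>\<^sup>+z. ennreal (indicator \<Omega> z * (k m (- \<rho> z) * p z)) \<partial>lborel) \<longlonglongrightarrow>
    (\<integral>\<^sup>+z. ennreal (indicator \<Omega> z * (k' (- \<rho> z) * p z)) \<partial>lborel)"
proof (rule nn_integral_LIMSEQ)
  show "incseq (\<lambda>m z. ennreal (indicator \<Omega> z * (k m (- \<rho> z) * p z)))"
  proof (intro incseq_SucI le_funI ennreal_leI)
    fix m z
    show "indicator \<Omega> z * (k m (- \<rho> z) * p z) \<le> indicator \<Omega> z * (k (Suc m) (- \<rho> z) * p z)"
      using mono[of "- \<rho> z" m "Suc m"] p[of z] neg[of z]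
      by (cases "z \<in> \<Omega>") (auto intro!: mult_right_mono)
  qed
  show "(\<lambda>z. ennreal (indicator \<Omega> z * (k m (- \<rho> z) * p z))) \<in> borel_measurable lborel" for m
    by (intro measurable_compose[OF measurable_indicator measurable_ennreal] continuous_intros
        continuous_on_compose_neg cont)
  fix z
  have "(\<lambda>m. indicator \<Omega> z * (k m (- \<rho> z) * p z)) \<longlonglongrightarrow> indicator \<Omega> z * (k' (- \<rho> z) * p z)"
    using lim[of "- \<rho> z"] neg[of z] by (cases "z \<in> \<Omega>") (auto intro!: tendsto_intros)
  then show "(\<lambda>m. ennreal (indicator \<Omega> z * (k m (- \<rho> z) * p z))) \<longlonglongrightarrow>
      ennreal (indicator \<Omega> z * (k' (- \<rho> z) * p z))"
    by (rule tendsto_ennrealI)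
qed

lemma integration_by_parts_powr:
  assumes ex: "exhaustion_on \<Omega> \<rho>" and \<beta>: "\<beta> > 0"
  shows "(\<integral>\<^sup>+z. ennreal (indicator \<Omega> z * ((real CARD('n) * (- \<rho> z) powr \<beta>) * hdet z)) \<partial>lborel) =
    (\<integral>\<^sup>+z. ennreal (indicator \<Omega> z * ((\<beta> * (- \<rho> z) powr (\<beta> - 1)) * (grad_sq z * hdet z))) \<partial>lborel)"
proof -
  define \<delta> where "\<delta> m = 1 / real (Suc m)" for m
  have \<delta>: "\<delta> m > 0" "m \<le> n \<Longrightarrow> \<delta> n \<le> \<delta> m" for m n by (simp_all add: \<delta>_def frac_le)
  have "(\<integral>\<^sup>+z. ennreal (indicator \<Omega> z * ((real CARD('n) * truncated_powr \<beta> (\<delta> m) (- \<rho> z)) * hdet z)) \<partial>lborel) =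
    (\<integral>\<^sup>+z. ennreal (indicator \<Omega> z * (truncated_powr' \<beta> (\<delta> m) (- \<rho> z) * (grad_sq z * hdet z))) \<partial>lborel)" for m
    using integration_by_parts[OF ex, of "\<delta> m powr (1 / \<beta>)" "truncated_powr \<beta> (\<delta> m)" "truncated_powr' \<beta> (\<delta> m)"]
      truncated_powr_has_derivative[OF _ \<delta>(1)] continuous_on_truncated_powr
      truncated_powr_eq_0[OF _ _ \<beta> \<delta>(1)] truncated_powr_nonneg[OF \<beta>] \<delta>(1)[of m]
    by (simp add: mult.assoc)
  moreover have "(\<lambda>m. \<integral>\<^sup>+z. ennreal (indicator \<Omega> z * ((real CARD('n) * truncated_powr \<beta> (\<delta> m) (- \<rho> z)) * hdet z)) \<partial>lborel)
    \<longlonglongrightarrow> (\<integral>\<^sup>+z. ennreal (indicator \<Omega> z * ((real CARD('n) * (- \<rho> z) powr \<beta>) * hdet z)) \<partial>lborel)"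
    by (rule nn_integral_monotone_limit)
      (use truncated_powr_antimono(1)[OF _ \<beta> \<delta>] truncated_powr_tendsto(1)[folded \<delta>_def] hdet_pos in
        \<open>auto intro!: continuous_intros continuous_on_truncated_powr continuous_on_hdet tendsto_intros mult_left_mono
          simp: less_imp_le\<close>)
  moreover have "(\<lambda>m. \<integral>\<^sup>+z. ennreal (indicator \<Omega> z * (truncated_powr' \<beta> (\<delta> m) (- \<rho> z) * (grad_sq z * hdet z))) \<partial>lborel)
    \<longlonglongrightarrow> (\<integral>\<^sup>+z. ennreal (indicator \<Omega> z * ((\<beta> * (- \<rho> z) powr (\<beta> - 1)) * (grad_sq z * hdet z))) \<partial>lborel)"
    by (rule nn_integral_monotone_limit)
      (use truncated_powr_antimono(2)[OF _ \<beta> \<delta>] truncated_powr_tendsto(2)[folded \<delta>_def] hdet_pos grad_sq_nonneg in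
        \<open>auto intro!: continuous_intros continuous_on_truncated_powr continuous_on_hdet continuous_on_grad_sq
          simp: less_imp_le\<close>)
  ultimately show ?thesis using LIMSEQ_unique by simp
qed

section \<open>Reduction to Lebesgue integrals over \<Omega>\<close>

lemma nn_integral_ddc_power_measure:
  assumes \<kappa>: "\<And>z. wedge_power (ddc u z) real_frame = \<kappa> * det (complex_hessian u z)"
    and D: "\<And>z. z \<in> \<Omega> \<Longrightarrow> det (complex_hessian u z) = of_real (D z)"
      "\<And>z. z \<in> \<Omega> \<Longrightarrow> D z \<ge> 0" "continuous_on \<Omega> D"
    and F: "\<And>z. z \<in> \<Omega> \<Longrightarrow> F z = F' z" "continuous_on \<Omega> F'"
  shows "(\<integral>\<^sup>+z. ennreal (F z) \<partial>ddc_power_measure \<Omega> u) =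
    ennreal (Re \<kappa>) * (\<integral>\<^sup>+z. ennreal (indicator \<Omega> z * (D z * F' z)) \<partial>lborel)"
proof -
  let ?N = "restrict_space lborel \<Omega>"
  have meas: "(\<lambda>z. ennreal (f z)) \<in> borel_measurable ?N"
    if "continuous_on \<Omega> f'" "\<And>z. z \<in> \<Omega> \<Longrightarrow> f z = f' z" for f f' :: "complex ^ 'n \<Rightarrow> real"
  proof -
    have "f' \<in> borel_measurable (restrict_space borel \<Omega>)"
      by (rule borel_measurable_continuous_on_restrict[OF that(1)])
    moreover have "sets ?N = sets (restrict_space borel \<Omega>)"
      by (rule sets_restrict_space_cong) simp
    ultimately have "f' \<in> borel_measurable ?N"
      using measurable_cong_sets[of ?N "restrict_space borel \<Omega>" borel borel] by auto
    then have "f \<in> borel_measurable ?N"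
      using measurable_cong[of ?N f f' borel] that(2) by (simp add: space_restrict_space)
    then show ?thesis by simp
  qed
  have dens: "Re (wedge_power (ddc u z) real_frame) = Re \<kappa> * D z" if "z \<in> \<Omega>" for z
    by (simp add: \<kappa> D(1)[OF that])
  have "(\<integral>\<^sup>+z. ennreal (F z) \<partial>ddc_power_measure \<Omega> u) =
    (\<integral>\<^sup>+z. ennreal (Re (wedge_power (ddc u z) real_frame)) * ennreal (F z) \<partial>?N)"
    unfolding ddc_power_measure_def
    by (intro nn_integral_density meas[OF _ dens] meas[OF F(2) F(1)] continuous_intros D(3))
  also have "\<dots> = (\<integral>\<^sup>+z. ennreal (Re \<kappa>) * ennreal (D z * F' z) \<partial>?N)"
  proof (rule nn_integral_cong)
    fix z assume "z \<in> space ?N"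
    then have z: "z \<in> \<Omega>" by (simp add: space_restrict_space)
    \<comment> \<open>The signs of \<open>Re \<kappa>\<close> and \<open>F' z\<close> are left open:
      \<open>ennreal\<close> of a product splits as soon as one factor, here \<open>D z\<close>, is
      nonnegative.\<close>
    show "ennreal (Re (wedge_power (ddc u z) real_frame)) * ennreal (F z) =
        ennreal (Re \<kappa>) * ennreal (D z * F' z)"
      unfolding dens[OF z] F(1)[OF z] ennreal_mult''[OF D(2)[OF z]] ennreal_mult'[OF D(2)[OF z]]
      by (rule mult.assoc)
  qed
  also have "\<dots> = ennreal (Re \<kappa>) * (\<integral>\<^sup>+z. ennreal (D z * F' z) \<partial>?N)"
    by (rule nn_integral_cmult) (auto intro!: meas[where f' = "\<lambda>z. D z * F' z"] continuous_intros D(3) F(2))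
  also have "(\<integral>\<^sup>+z. ennreal (D z * F' z) \<partial>?N) = (\<integral>\<^sup>+z. ennreal (D z * F' z) * indicator \<Omega> z \<partial>lborel)"
    using open_\<Omega> by (intro nn_integral_restrict_space) simp
  also have "\<dots> = (\<integral>\<^sup>+z. ennreal (indicator \<Omega> z * (D z * F' z)) \<partial>lborel)"
    by (intro nn_integral_cong) (auto simp: indicator_def)
  finally show ?thesis .
qed

section \<open>Volume density and gradient norm for the metric of g\<close>

lemma complex_hessian_neg_ln:
  assumes z: "z \<in> \<Omega>"
  shows "complex_hessian (\<lambda>z. - ln (- \<rho> z)) z =
    (\<chi> i j. of_real (1 / - \<rho> z) * (\<chi> i j. H z $ i $ j + del z $ i * (cnj (del z $ j) / of_real (- \<rho> z))) $ i $ j)"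
proof -
  have "dz i (dzbar j (\<lambda>w. complex_of_real (- ln (- \<rho> w)))) z =
      dz i (\<lambda>w. of_real (1 / - \<rho> w) * dzbar j \<rho>\<^sub>c w) z" for i j
  proof (rule dz_cong_open(1)[OF open_\<Omega> z])
    fix w assume w: "w \<in> \<Omega>"
    have "((\<lambda>t. - ln (- t)) has_real_derivative 1 / - \<rho> w) (at (\<rho> w))"
      using neg[OF w] by (auto intro!: derivative_eq_intros)
    from dz_of_real_compose(3)[OF diff_\<rho>[OF w] this]
    show "dzbar j (\<lambda>w. complex_of_real (- ln (- \<rho> w))) w = of_real (1 / - \<rho> w) * dzbar j \<rho>\<^sub>c w" .
  qed
  moreover have "((\<lambda>t. 1 / - t) has_real_derivative 1 / (\<rho> z)\<^sup>2) (at (\<rho> z))"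
    using neg[OF z] by (auto intro!: derivative_eq_intros simp: power2_eq_square)
  note dz_compose_mult_dzbar[OF z this]
  ultimately show ?thesis
    using neg[OF z] by (simp add: complex_hessian_def vec_eq_iff power2_eq_square field_simps)
qed

text \<open>The Hessian was written as a scalar times a rank-one update to match the two determinant
  lemmas used here. The power of \<open>- \<rho> z\<close> becomes a \<open>powr\<close> so that it
  can later merge with the real powers in the integrands.\<close>

lemma det_complex_hessian_neg_ln:
  assumes z: "z \<in> \<Omega>"
  shows "det (complex_hessian (\<lambda>z. - ln (- \<rho> z)) z) =
    of_real ((- \<rho> z) powr - real CARD('n) * hdet z * (1 + grad_sq z / - \<rho> z))"
proof -
  have "(\<Sum>j\<in>UNIV. cnj (del z $ j) / of_real (- \<rho> z) * grad z $ j) =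
      (\<Sum>j\<in>UNIV. cnj (del z $ j) * grad z $ j) / of_real (- \<rho> z)"
    by (simp add: sum_divide_distrib sum_negf)
  also have "\<dots> = of_real (grad_sq z / - \<rho> z)" by (simp add: of_real_grad_sq[OF z])
  finally have s: "(\<Sum>j\<in>UNIV. cnj (del z $ j) / of_real (- \<rho> z) * grad z $ j) = of_real (grad_sq z / - \<rho> z)" .
  have "(1 / - \<rho> z) ^ CARD('n) = (- \<rho> z) powr - real CARD('n)"
    using neg[OF z] by (simp only: powr_minus powr_realpow neg_0_less_iff_less power_divide power_one
        inverse_eq_divide)
  then show ?thesis
    unfolding complex_hessian_neg_ln[OF z] det_scaleR_matrix det_rank_one_update[OF H_grad[OF z]] s det_H[OF z]
    by (metis (no_types, opaque_lifting) mult.assoc of_real_1 of_real_add of_real_mult of_real_power)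
qed

text \<open>Since \<partial>f is a multiple of \<partial>\<rho>, the inverse of the Hessian
  \<open>G\<close> of g matters only at \<open>del z\<close>. As \<open>G\<close> maps
  \<open>grad z\<close> to \<open>del z\<close> times e / r, the inverse maps \<open>del z\<close>
  to \<open>grad z\<close> times r / e.\<close>

lemma norm_del_sq_powr:
  assumes z: "z \<in> \<Omega>"
  shows "norm_del_sq (\<lambda>z. - ln (- \<rho> z)) (\<lambda>z. (- \<rho> z) powr \<alpha>) z =
    \<alpha>\<^sup>2 * (- \<rho> z) powr (2 * \<alpha> - 1) * grad_sq z / (1 + grad_sq z / - \<rho> z)"
proof -
  define r where "r = - \<rho> z"
  define G where "G = complex_hessian (\<lambda>z. - ln (- \<rho> z)) z"
  define k where "k = - (\<alpha> * r powr (\<alpha> - 1))"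
  define e where "e = 1 + grad_sq z / r"
  have r: "r > 0" using neg[OF z] by (simp add: r_def)
  have e: "e > 0" using r grad_sq_nonneg[OF z] by (simp add: e_def add_pos_nonneg)
  have "det G = of_real (r powr - real CARD('n) * hdet z * e)"
    unfolding G_def det_complex_hessian_neg_ln[OF z] r_def e_def ..
  then have detG: "det G \<noteq> 0" using r e hdet_pos[OF z] by simp
  have s: "(\<Sum>j\<in>UNIV. cnj (del z $ j) / of_real r * grad z $ j) = of_real (grad_sq z / r)"
    using of_real_grad_sq[OF z] by (simp flip: sum_divide_distrib)
  have "G *v grad z = of_real (1 / r) *s
      ((\<chi> i j. H z $ i $ j + del z $ i * (cnj (del z $ j) / of_real r)) *v grad z)"
    unfolding G_def complex_hessian_neg_ln[OF z] r_def
    by (simp only: matrix_vector_mult_def vec_eq_iff sum_distrib_left mult.assoc vec_lambda_beta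
        vector_smult_component simp_thms)
  also have "\<dots> = of_real (e / r) *s del z"
    unfolding rank_one_update_solution[OF H_grad[OF z]] s vector_smult_assoc by (simp add: e_def)
  finally have Gw: "G *v grad z = of_real (e / r) *s del z" .
  have "matrix_inv G *v del z = of_real (r / e) *s (matrix_inv G *v (G *v grad z))"
    unfolding Gw vector_scalar_commute using r e by simp
  also have "\<dots> = of_real (r / e) *s grad z"
    using matrix_inv_inverse(2)[OF detG] by (simp add: matrix_vector_mul_assoc)
  finally have inv: "matrix_inv G *v del z = of_real (r / e) *s grad z" .
  have "((\<lambda>t. (- t) powr \<alpha>) has_real_derivative k) (at (\<rho> z))"
    using r unfolding k_def r_def by (auto intro!: derivative_eq_intros)
  note D = dz_of_real_compose(2,3)[OF diff_\<rho>[OF z] this]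
  have "(\<Sum>i\<in>UNIV. \<Sum>j\<in>UNIV. matrix_inv G $ j $ i * dz i (\<lambda>w. complex_of_real ((- \<rho> w) powr \<alpha>)) z *
      dzbar j (\<lambda>w. complex_of_real ((- \<rho> w) powr \<alpha>)) z) =
    (\<Sum>i\<in>UNIV. \<Sum>j\<in>UNIV. of_real (k\<^sup>2) * (cnj (del z $ j) * (matrix_inv G $ j $ i * del z $ i)))"
    unfolding D dzbar_\<rho>\<^sub>c[OF z] by (simp add: del_def power2_eq_square mult_ac)
  also have "\<dots> = of_real (k\<^sup>2) * (\<Sum>j\<in>UNIV. cnj (del z $ j) * (matrix_inv G *v del z) $ j)"
    by (subst sum.swap) (simp add: matrix_vector_mult_def sum_distrib_left)
  also have "(\<Sum>j\<in>UNIV. cnj (del z $ j) * (matrix_inv G *v del z) $ j) =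
      of_real (r / e) * (\<Sum>j\<in>UNIV. cnj (del z $ j) * grad z $ j)"
    unfolding inv by (simp add: sum_distrib_left mult_ac)
  finally have "norm_del_sq (\<lambda>z. - ln (- \<rho> z)) (\<lambda>z. (- \<rho> z) powr \<alpha>) z = k\<^sup>2 * (r / e * grad_sq z)"
    unfolding norm_del_sq_def G_def[symmetric] of_real_grad_sq[OF z] by simp
  also have "k\<^sup>2 * r = \<alpha>\<^sup>2 * r powr (2 * \<alpha> - 1)"
  proof -
    have "(r powr (\<alpha> - 1))\<^sup>2 * r = r powr (\<alpha> - 1) * r powr (\<alpha> - 1) * r powr 1"
      using r by (simp add: power2_eq_square)
    also have "\<dots> = r powr (2 * \<alpha> - 1)" by (simp only: powr_add[symmetric]) simp
    finally show ?thesis by (simp add: k_def power_mult_distrib mult.assoc)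
  qed
  then have "k\<^sup>2 * (r / e * grad_sq z) = \<alpha>\<^sup>2 * r powr (2 * \<alpha> - 1) * grad_sq z / e"
    by (simp add: field_simps)
  finally show ?thesis by (simp add: r_def e_def)
qed

section \<open>The equivalence and the two identities\<close>

lemma powr_W12_iff:
  fixes \<alpha> :: real
  assumes ex: "exhaustion_on \<Omega> \<rho>" and "\<alpha> > real CARD('n) / 2"
  defines "g \<equiv> \<lambda>z. - ln (- \<rho> z)" and "f \<equiv> \<lambda>z. (- \<rho> z) powr \<alpha>"
  shows "(f \<in> smooth_W12 \<Omega> g \<longleftrightarrow>
            (\<integral>\<^sup>+ z. ennreal ((- \<rho> z) powr (2 * \<alpha> - real CARD('n))) \<partial>ddc_power_measure \<Omega> \<rho>) < \<infinity>)
       \<and> (f \<in> smooth_W12 \<Omega> g \<longrightarrow>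
            (\<integral>\<^sup>+ z. ennreal ((f z)\<^sup>2) \<partial>ddc_power_measure \<Omega> g)
              = ennreal (2 * \<alpha> / (2 * \<alpha> - real CARD('n)))
                * (\<integral>\<^sup>+ z. ennreal ((- \<rho> z) powr (2 * \<alpha> - real CARD('n))) \<partial>ddc_power_measure \<Omega> \<rho>)
          \<and> 4 * (\<integral>\<^sup>+ z. ennreal (norm_del_sq g f z) \<partial>ddc_power_measure \<Omega> g)
              = ennreal (2 * \<alpha> * real CARD('n))
                * (\<integral>\<^sup>+ z. ennreal ((f z)\<^sup>2) \<partial>ddc_power_measure \<Omega> g))"
proof -
  obtain \<kappa> where \<kappa>: "\<And>(u :: complex^'n \<Rightarrow> real) z.
      wedge_power (ddc u z) real_frame = \<kappa> * det (complex_hessian u z)"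
    by (rule wedge_power_ddc) (rule that)
  define n where "n = real CARD('n)"
  define \<beta> where "\<beta> = 2 * \<alpha> - n"
  have n: "n > 0" and \<beta>: "\<beta> > 0" and \<alpha>: "\<alpha> > 0"
    using \<open>\<alpha> > real CARD('n) / 2\<close> by (auto simp: n_def \<beta>_def intro: le_less_trans[rotated])
  have r: "- \<rho> z > 0" if "z \<in> \<Omega>" for z using neg[OF that] by simp
  have cont_powr: "continuous_on \<Omega> (\<lambda>z. (- \<rho> z) powr x)" for x
    by (rule continuous_on_compose_neg) (auto intro!: continuous_intros)
  have smooth: "smooth_on \<Omega> f"
  proof -
    have "Ck_on k \<Omega> (\<lambda>z. - \<rho> z)" for k
      by (rule Ck_on_bounded_linear[OF open_\<Omega> bounded_linear_minus[OF bounded_linear_ident] Ck_\<rho>])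
    then show ?thesis
      unfolding smooth_on_def f_def using r by (intro allI Ck_on_powr open_\<Omega>) auto
  qed
  \<comment> \<open>Up to the common factor, the integral of f^2 is \<open>A + B\<close> and that of
    the squared gradient norm is \<alpha>^2 times \<open>B\<close>. Integration by parts gives
    \<open>B\<close> as n / \<beta> times \<open>A\<close>, whence the constants 1 + n / \<beta> = 2
    \<alpha> / \<beta> and \<alpha>^2 n / \<beta>.\<close>
  define A where "A = (\<integral>\<^sup>+z. ennreal (indicator \<Omega> z * (hdet z * (- \<rho> z) powr \<beta>)) \<partial>lborel)"
  define B where "B = (\<integral>\<^sup>+z. ennreal (indicator \<Omega> z * (grad_sq z * hdet z * (- \<rho> z) powr (\<beta> - 1))) \<partial>lborel)"
  have meas: "(\<lambda>z. ennreal (indicator \<Omega> z * h z)) \<in> borel_measurable lborel" if "continuous_on \<Omega> h" for h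
    by (rule measurable_compose[OF measurable_indicator[OF that] measurable_ennreal])
  have contA: "continuous_on \<Omega> (\<lambda>z. hdet z * (- \<rho> z) powr \<beta>)"
    by (intro continuous_intros continuous_on_hdet cont_powr)
  have contB: "continuous_on \<Omega> (\<lambda>z. grad_sq z * hdet z * (- \<rho> z) powr (\<beta> - 1))"
    by (intro continuous_intros continuous_on_hdet continuous_on_grad_sq cont_powr)
  have scale: "(\<integral>\<^sup>+z. ennreal (indicator \<Omega> z * (x * h z)) \<partial>lborel) =
      ennreal x * (\<integral>\<^sup>+z. ennreal (indicator \<Omega> z * h z) \<partial>lborel)"
    if "x \<ge> 0" "continuous_on \<Omega> h" for x h
  proof -
    have "ennreal (indicator \<Omega> z * (x * h z)) = ennreal x * ennreal (indicator \<Omega> z * h z)" for z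
      using that(1) by (simp add: mult.left_commute flip: ennreal_mult')
    then show ?thesis using nn_integral_cmult[OF meas[OF that(2)]] by simp
  qed
  have AB: "ennreal n * A = ennreal \<beta> * B"
    using integration_by_parts_powr[OF ex \<beta>] scale[OF less_imp_le[OF n] contA] scale[OF less_imp_le[OF \<beta>] contB]
    by (simp add: A_def B_def n_def mult_ac)
  \<comment> \<open>Both \<open>A\<close> and \<open>B\<close> may be infinite, so the equation is
    solved for \<open>B\<close> by multiplying with the finite constant 1 / \<beta>.\<close>
  have "B = ennreal (1 / \<beta>) * (ennreal \<beta> * B)"
    using \<beta> by (simp add: mult.assoc[symmetric] flip: ennreal_mult)
  also have "\<dots> = ennreal (n / \<beta>) * A"
    using \<beta> n by (simp add: AB[symmetric] mult.assoc[symmetric] flip: ennreal_mult)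
  finally have B: "B = ennreal (n / \<beta>) * A" .
  define X where "X = ennreal (Re \<kappa>) * A"
  have I\<rho>: "(\<integral>\<^sup>+z. ennreal ((- \<rho> z) powr (2 * \<alpha> - real CARD('n))) \<partial>ddc_power_measure \<Omega> \<rho>) = X"
    unfolding X_def A_def \<beta>_def n_def
    by (rule nn_integral_ddc_power_measure[OF \<kappa> det_H _ continuous_on_hdet refl cont_powr])
      (simp_all add: hdet_pos less_imp_le)
  define D where "D z = (- \<rho> z) powr - n * hdet z * (1 + grad_sq z / - \<rho> z)" for z
  have D: "det (complex_hessian g z) = of_real (D z)" "D z \<ge> 0" if "z \<in> \<Omega>" for z
  proof -
    show "det (complex_hessian g z) = of_real (D z)"
      unfolding g_def D_def n_def by (rule det_complex_hessian_neg_ln[OF that])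
    show "D z \<ge> 0"
      unfolding D_def using hdet_pos[OF that] grad_sq_nonneg[OF that] r[OF that]
      by (intro mult_nonneg_nonneg add_nonneg_nonneg divide_nonneg_pos) auto
  qed
  have contD: "continuous_on \<Omega> D"
    unfolding D_def[abs_def]
    by (intro continuous_intros continuous_on_hdet continuous_on_grad_sq cont_powr continuous_on_\<rho>) (use r in force)
  have If: "(\<integral>\<^sup>+z. ennreal ((f z)\<^sup>2) \<partial>ddc_power_measure \<Omega> g) = ennreal (2 * \<alpha> / \<beta>) * X"
  proof -
    have "(f z)\<^sup>2 = (- \<rho> z) powr (2 * \<alpha>)" if "z \<in> \<Omega>" for z
      using r[OF that] by (simp add: f_def power2_eq_square flip: powr_add)
    then have "(\<integral>\<^sup>+z. ennreal ((f z)\<^sup>2) \<partial>ddc_power_measure \<Omega> g) = ennreal (Re \<kappa>) *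
        (\<integral>\<^sup>+z. ennreal (indicator \<Omega> z * (D z * (- \<rho> z) powr (2 * \<alpha>))) \<partial>lborel)"
      by (intro nn_integral_ddc_power_measure[OF \<kappa> D contD _ cont_powr])
    also have "(\<integral>\<^sup>+z. ennreal (indicator \<Omega> z * (D z * (- \<rho> z) powr (2 * \<alpha>))) \<partial>lborel) =
        (\<integral>\<^sup>+z. ennreal (indicator \<Omega> z * (hdet z * (- \<rho> z) powr \<beta>)) +
          ennreal (indicator \<Omega> z * (grad_sq z * hdet z * (- \<rho> z) powr (\<beta> - 1))) \<partial>lborel)"
    proof (intro nn_integral_cong)
      fix z
      show "ennreal (indicator \<Omega> z * (D z * (- \<rho> z) powr (2 * \<alpha>))) =
        ennreal (indicator \<Omega> z * (hdet z * (- \<rho> z) powr \<beta>)) +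
        ennreal (indicator \<Omega> z * (grad_sq z * hdet z * (- \<rho> z) powr (\<beta> - 1)))"
      proof (cases "z \<in> \<Omega>")
        case True
        have p: "(- \<rho> z) powr \<beta> = (- \<rho> z) powr (2 * \<alpha>) * (- \<rho> z) powr - n"
          by (simp add: \<beta>_def flip: powr_add)
        have p1: "(- \<rho> z) powr (\<beta> - 1) = (- \<rho> z) powr \<beta> / - \<rho> z"
          using r[OF True] by (simp add: powr_diff)
        have "D z * (- \<rho> z) powr (2 * \<alpha>) = hdet z * (- \<rho> z) powr \<beta> + grad_sq z * hdet z * (- \<rho> z) powr (\<beta> - 1)"
          unfolding p1 D_def p by (simp only: algebra_simps times_divide_eq_left times_divide_eq_right)
        then show ?thesis
          using True hdet_pos[OF True] grad_sq_nonneg[OF True] by (simp add: ennreal_plus)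
      qed simp
    qed
    also have "\<dots> = A + B"
      unfolding A_def B_def by (rule nn_integral_add[OF meas[OF contA] meas[OF contB]])
    also have "\<dots> = ennreal (2 * \<alpha> / \<beta>) * A"
    proof -
      have "2 * \<alpha> / \<beta> = 1 + n / \<beta>" using \<beta> by (simp add: \<beta>_def field_simps)
      then show ?thesis using n \<beta> by (simp add: B ennreal_plus distrib_right)
    qed
    finally show ?thesis by (simp add: X_def mult.left_commute)
  qed
  have Idel: "(\<integral>\<^sup>+z. ennreal (norm_del_sq g f z) \<partial>ddc_power_measure \<Omega> g) = ennreal (\<alpha>\<^sup>2 * n / \<beta>) * X"
  proof -
    define E where "E z = \<alpha>\<^sup>2 * (- \<rho> z) powr (2 * \<alpha> - 1) * grad_sq z / (1 + grad_sq z / - \<rho> z)" for z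
    have e: "1 + grad_sq z / - \<rho> z > 0" if "z \<in> \<Omega>" for z
      using r[OF that] grad_sq_nonneg[OF that] by (intro add_pos_nonneg divide_nonneg_pos) auto
    have contE: "continuous_on \<Omega> E"
      unfolding E_def[abs_def]
      by (intro continuous_intros continuous_on_grad_sq cont_powr continuous_on_\<rho>) (use r e in force)+
    have "(\<integral>\<^sup>+z. ennreal (norm_del_sq g f z) \<partial>ddc_power_measure \<Omega> g) = ennreal (Re \<kappa>) *
        (\<integral>\<^sup>+z. ennreal (indicator \<Omega> z * (D z * E z)) \<partial>lborel)"
      unfolding f_def
      by (rule nn_integral_ddc_power_measure[OF \<kappa> D contD _ contE])
        (simp_all only: g_def norm_del_sq_powr E_def)
    also have "(\<integral>\<^sup>+z. ennreal (indicator \<Omega> z * (D z * E z)) \<partial>lborel) =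
        (\<integral>\<^sup>+z. ennreal (indicator \<Omega> z * (\<alpha>\<^sup>2 * (grad_sq z * hdet z * (- \<rho> z) powr (\<beta> - 1)))) \<partial>lborel)"
    proof (intro nn_integral_cong)
      fix z
      show "ennreal (indicator \<Omega> z * (D z * E z)) =
        ennreal (indicator \<Omega> z * (\<alpha>\<^sup>2 * (grad_sq z * hdet z * (- \<rho> z) powr (\<beta> - 1))))"
      proof (cases "z \<in> \<Omega>")
        case True
        have p: "(- \<rho> z) powr (\<beta> - 1) = (- \<rho> z) powr - n * (- \<rho> z) powr (2 * \<alpha> - 1)"
          by (simp add: \<beta>_def algebra_simps flip: powr_add)
        \<comment> \<open>This factor of the volume density is the denominator of the gradient norm;
          it cancels, and only a multiple of the integrand of \<open>B\<close> remains.\<close>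
        define e where "e = 1 + grad_sq z / - \<rho> z"
        have "e > 0" unfolding e_def by (rule e[OF True])
        then have "D z * E z = \<alpha>\<^sup>2 * (grad_sq z * hdet z * (- \<rho> z) powr (\<beta> - 1))"
          unfolding D_def E_def p e_def[symmetric] by (simp add: field_simps)
        then show ?thesis by simp
      qed simp
    qed
    also have "\<dots> = ennreal (\<alpha>\<^sup>2) * B"
      unfolding B_def by (rule scale[OF _ contB]) simp
    finally show ?thesis
      using n \<beta> by (simp add: X_def B mult_ac flip: ennreal_mult mult.assoc)
  qed
  \<comment> \<open>For the forward direction of the equivalence: the constant is at least 1, so
    finiteness of the integral of f^2 forces \<open>X\<close> to be finite.\<close>
  have X_le: "X \<le> ennreal (2 * \<alpha> / \<beta>) * X"
  proof -
    have "ennreal 1 \<le> ennreal (2 * \<alpha> / \<beta>)"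
      using \<beta> n by (intro ennreal_leI) (simp add: \<beta>_def)
    from mult_right_mono[OF this, of X] show ?thesis by simp
  qed
  have "f \<in> smooth_W12 \<Omega> g \<longleftrightarrow> X < \<infinity>"
    using smooth X_le
    by (auto simp: smooth_W12_def If Idel ennreal_mult_less_top intro: le_less_trans)
  moreover have "4 * (ennreal (\<alpha>\<^sup>2 * n / \<beta>) * X) = ennreal (2 * \<alpha> * n) * (ennreal (2 * \<alpha> / \<beta>) * X)"
  proof -
    have "4 * ennreal (\<alpha>\<^sup>2 * n / \<beta>) = ennreal (4 * (\<alpha>\<^sup>2 * n / \<beta>))"
      using ennreal_mult'[of 4 "\<alpha>\<^sup>2 * n / \<beta>"] by simp
    also have "4 * (\<alpha>\<^sup>2 * n / \<beta>) = 2 * \<alpha> * n * (2 * \<alpha> / \<beta>)"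
      by (simp add: power2_eq_square)
    also have "ennreal \<dots> = ennreal (2 * \<alpha> * n) * ennreal (2 * \<alpha> / \<beta>)"
      using n \<alpha> by (intro ennreal_mult') simp
    finally show ?thesis by (metis mult.assoc)
  qed
  ultimately show ?thesis
    unfolding I\<rho> If Idel by (simp add: \<beta>_def n_def)
qed

end

theorem proposition3p1:
  fixes \<Omega> :: "(complex ^ 'n) set"
    and \<rho> g f :: "complex ^ 'n \<Rightarrow> real"
    and \<alpha> :: real
  assumes "open \<Omega>" and "connected \<Omega>" and "\<Omega> \<noteq> {}" and "bounded \<Omega>"
    and "\<forall>z\<in>\<Omega>. -1 \<le> \<rho> z \<and> \<rho> z < 0"
    and "smooth_strictly_psh_on \<Omega> \<rho>"
    and "exhaustion_on \<Omega> \<rho>"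
    and "g = (\<lambda>z. - ln (- \<rho> z))"
    and "\<alpha> > real CARD('n) / 2"
    and "f = (\<lambda>z. (- \<rho> z) powr \<alpha>)"
  shows "(f \<in> smooth_W12 \<Omega> g \<longleftrightarrow>
            (\<integral>\<^sup>+ z. ennreal ((- \<rho> z) powr (2 * \<alpha> - real CARD('n))) \<partial>ddc_power_measure \<Omega> \<rho>) < \<infinity>)
       \<and> (f \<in> smooth_W12 \<Omega> g \<longrightarrow>
            (\<integral>\<^sup>+ z. ennreal ((f z)\<^sup>2) \<partial>ddc_power_measure \<Omega> g)
              = ennreal (2 * \<alpha> / (2 * \<alpha> - real CARD('n)))
                * (\<integral>\<^sup>+ z. ennreal ((- \<rho> z) powr (2 * \<alpha> - real CARD('n))) \<partial>ddc_power_measure \<Omega> \<rho>)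
          \<and> 4 * (\<integral>\<^sup>+ z. ennreal (norm_del_sq g f z) \<partial>ddc_power_measure \<Omega> g)
              = ennreal (2 * \<alpha> * real CARD('n))
                * (\<integral>\<^sup>+ z. ennreal ((f z)\<^sup>2) \<partial>ddc_power_measure \<Omega> g))"
proof -
  have "negative_strictly_psh \<Omega> \<rho>"
    using assms(1,5,6) by unfold_locales auto
  from negative_strictly_psh.powr_W12_iff[OF this assms(7,9)]
  show ?thesis unfolding assms(8,10) .
qed

end
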